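(* Let $\nu_0=n-\nu_1-\cdots-\nu_p$. Problem 2C (stated in the context) is solvable if and only if $$\dim\Big(\mathcal V^\star_g+\sum_{i\in P}\mathcal L_i\Big)\ge\sum_{i\in P}\nu_i+\nu_0$$ and $$\dim\Big(\sum_{i\in P}\mathcal L_i\Big)\ge\sum_{i\in P}\nu_i$$ for all $P$ in the power set $2^I$, where $I=\{1,\ldots,p\}$.
   Context: System: $\Sigma=(A,B,C,D)$ is $\mathcal D x=Ax+Bu$, $y=Cx+Du$, $x(t)\in\mathbb R^n$, $u(t)\in\mathbb R^m$, $y(t)\in\mathbb R^p$, real matrices; $\mathcal D x=\dot x$ (continuous time) or $x(t+1)$ (discrete time). $\mathbb C_g$ is the open left half-plane (continuous) or open unit disc (discrete), $\mathbb R_g=\mathbb C_g\cap\mathbb R$. Invariant zeros of $\Sigma$ are those $\lambda\in\mathbb C$ at which the rank of $\begin{bmatrix}A-\lambda I&B\\C&D\end{bmatrix}$ is below its normal rank; minimum-phase zeros are those in $\mathbb C_g$. Standing assumptions: $\Sigma$ is right invertible (that matrix pencil has full row rank for all but finitely many $\lambda$), stabilizable, with no invariant zero at $0$ (continuous) or $1$ (discrete); algebraic and geometric multiplicities of each minimum-phase invariant zero coincide; no Jordan chains are allowed in the closed loop ($A+BF$ diagonalizable); in this part all closed-loop eigenvalues considered and all minimum-phase invariant zeros are real. Control: $u=Fx+Gr$, $F$ real with $\sigma(A+BF)\subset\mathbb C_g$, $G$ a right inverse of the closed-loop static gain. For constant $r$, $\epsilon=y-r$ satisfies $\mathcal D\xi=(A+BF)\xi$,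 $\epsilon=(C+DF)\xi$. State-to-output decoupling: for any initial condition, $\epsilon_i(t)=\sum_{j=1}^{\nu_i}\beta_{i,j}e^{\lambda_{i,j}t}$ (resp. $\sum_j\beta_{i,j}\lambda_{i,j}^t$), $i=1,\ldots,p$, where the $\lambda_{i,j}$ are the observable closed-loop eigenvalues and the coefficients $\beta_{i,j}$ can be made arbitrary by choice of $\xi(0)$. That is, $A+BF$ has a basis of eigenvectors $v_{0,1},\ldots,v_{0,\nu_0},v_{1,1},\ldots,v_{p,\nu_p}$ with eigenvalues $\lambda_{i,j}$ such that $(C+DF)v_{0,j}=0$ and $(C+DF)v_{i,j}$ is a nonzero multiple of the $i$-th canonical vector $e_i\in\mathbb R^p$ for $i\ge1$; the $\lambda_{i,j}$ ($1\le j\le\nu_i$) are the eigenvalues observable from $\epsilon_i$ and the $\lambda_{0,j}$ the unobservable ones (all counted with multiplicity). Problem 2C: given nonnegative integers $\nu_1,\ldots,\nu_p$ with $\nu_0=n-\sum_i\nu_i\ge0$, find $F,G$ such that: (1) $y(t)\to\bar r$ for every constant reference $r(t)=\bar r$; (2) state-to-output decoupling is achieved; (3) from each $\epsilon_i$ exactly $\nu_i$ eigenvalues are observable (these may be minimum-phase invariant zeros); neither the observable nor the unobservable eigenvalues are assigned a priori. Solvable means such $F,G$ exist. Subspaces: $\mathcal L_i=\operatorname{span}_{\mathbb R}L_i$ with $L_i=\{v\in\mathbb R^n\mid\exists\lambda\in\mathbb R_g,\ \exists w\in\mathbb R^m,\ \exists\delta\in\mathbb R\setminus\{0\}:\ (A-\lambda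 I)v+Bw=0,\ Cv+Dw=\delta e_i\}$. $\mathcal V^\star_g$ is the largest stabilizability output-nulling subspace of $\Sigma$: the largest subspace $\mathcal V\subseteq\mathbb R^n$ for which there is a real $F$ with $(A+BF)\mathcal V\subseteq\mathcal V\subseteq\ker(C+DF)$ and $\sigma(A+BF|\mathcal V)\subset\mathbb C_g$. *)

theory Defs
  imports
    "HOL-Analysis.Analysis"
    "HOL-Library.Set_Algebras"
    "HOL-Combinatorics.Permutations"
    "HOL-Computational_Algebra.Computational_Algebra"
    "HOL-Computational_Algebra.Field_as_Ring"
begin

datatype time_domain = Continuous | Discrete

fun stability_region :: "time_domain \<Rightarrow> complex set" where
  "stability_region Continuous = {z. Re z < 0}"
| "stability_region Discrete = {z. cmod z < 1}"

definition real_stability_region :: "time_domain \<Rightarrow> real set" where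
  "real_stability_region td = {x. complex_of_real x \<in> stability_region td}"

text \<open>The frequency of constant signals: equilibria satisfy \<open>s x = A x + B u\<close> with this \<open>s\<close>.\<close>

fun static_frequency :: "time_domain \<Rightarrow> real" where
  "static_frequency Continuous = 0"
| "static_frequency Discrete = 1"

subsection \<open>Spectra\<close>

text \<open>
  The spectrum of the restriction of a real matrix to an invariant real subspace. It is a set of
  complex numbers, so eigenvectors range over the complexification of the subspace, i.e. over the
  complex vectors whose real and imaginary parts both lie in it.
\<close>

definition spectrum_on :: "real^'n^'n \<Rightarrow> (real^'n) set \<Rightarrow> complex set" where
  "spectrum_on M V = {l. \<exists>z. z \<noteq> 0 \<and> (\<chi> i. Re (z $ i)) \<in> V \<and> (\<chi> i. Im (z $ i)) \<in> V \<and>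
     map_matrix complex_of_real M *v z = l *s z}"

definition stabilizing :: "time_domain \<Rightarrow> real^'n^'n \<Rightarrow> real^'m^'n \<Rightarrow> real^'n^'m \<Rightarrow> bool" where
  "stabilizing td A B F \<longleftrightarrow> spectrum_on (A + B ** F) UNIV \<subseteq> stability_region td"

definition stabilizable :: "time_domain \<Rightarrow> real^'n^'n \<Rightarrow> real^'m^'n \<Rightarrow> bool" where
  "stabilizable td A B \<longleftrightarrow> (\<exists>F. stabilizing td A B F)"

subsection \<open>System pencil and invariant zeros\<close>

definition block_matrix ::
  "'a^'n^'r \<Rightarrow> 'a^'m^'r \<Rightarrow> 'a^'n^'s \<Rightarrow> 'a^'m^'s \<Rightarrow> 'a^('n + 'm)^('r + 's)" where
  "block_matrix P Q R S = (\<chi> i j.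
     case i of
       Inl a \<Rightarrow> (case j of Inl b \<Rightarrow> P $ a $ b | Inr b \<Rightarrow> Q $ a $ b)
     | Inr a \<Rightarrow> (case j of Inl b \<Rightarrow> R $ a $ b | Inr b \<Rightarrow> S $ a $ b))"

definition pencil :: "real^'n^'n \<Rightarrow> real^'m^'n \<Rightarrow> real^'n^'p \<Rightarrow> real^'m^'p \<Rightarrow> complex
    \<Rightarrow> complex^('n + 'm)^('n + 'p)" where
  "pencil A B C D l = block_matrix
     (map_matrix complex_of_real A - mat l) (map_matrix complex_of_real B)
     (map_matrix complex_of_real C) (map_matrix complex_of_real D)"

definition normal_rank :: "real^'n^'n \<Rightarrow> real^'m^'n \<Rightarrow> real^'n^'p \<Rightarrow> real^'m^'p \<Rightarrow> nat" where
  "normal_rank A B C D = Max (range (\<lambda>l. rank (pencil A B C D l)))"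

definition invariant_zeros ::
  "real^'n^'n \<Rightarrow> real^'m^'n \<Rightarrow> real^'n^'p \<Rightarrow> real^'m^'p \<Rightarrow> complex set" where
  "invariant_zeros A B C D = {l. rank (pencil A B C D l) < normal_rank A B C D}"

definition minimum_phase_zeros ::
  "time_domain \<Rightarrow> real^'n^'n \<Rightarrow> real^'m^'n \<Rightarrow> real^'n^'p \<Rightarrow> real^'m^'p \<Rightarrow> complex set" where
  "minimum_phase_zeros td A B C D = invariant_zeros A B C D \<inter> stability_region td"

definition right_invertible :: "real^'n^'n \<Rightarrow> real^'m^'n \<Rightarrow> real^'n^'p \<Rightarrow> real^'m^'p \<Rightarrow> bool" where
  "right_invertible A B C D \<longleftrightarrow>
     finite {l. rank (pencil A B C D l) \<noteq> CARD('n) + CARD('p)}"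

text \<open>
  The geometric multiplicity of an invariant zero is the rank deficiency of the pencil there. The
  algebraic multiplicity is its multiplicity as a root of the zero polynomial, i.e. of the product
  of the invariant polynomials of the pencil, which is the determinantal divisor of order the
  normal rank: the gcd of all minors of that order.
\<close>

definition geometric_multiplicity ::
  "real^'n^'n \<Rightarrow> real^'m^'n \<Rightarrow> real^'n^'p \<Rightarrow> real^'m^'p \<Rightarrow> complex \<Rightarrow> nat" where
  "geometric_multiplicity A B C D l = normal_rank A B C D - rank (pencil A B C D l)"

definition pencil_poly :: "real^'n^'n \<Rightarrow> real^'m^'n \<Rightarrow> real^'n^'p \<Rightarrow> real^'m^'p
    \<Rightarrow> complex poly^('n + 'm)^('n + 'p)" where
  "pencil_poly A B C D = block_matrix
     (map_matrix (\<lambda>x. [:complex_of_real x:]) A - mat [:0, 1:])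
     (map_matrix (\<lambda>x. [:complex_of_real x:]) B)
     (map_matrix (\<lambda>x. [:complex_of_real x:]) C)
     (map_matrix (\<lambda>x. [:complex_of_real x:]) D)"

text \<open>
  The order is a natural number rather than a type, so the determinant of the submatrix with rows
  \<open>f 0, \<dots>, f (k - 1)\<close> and columns \<open>g 0, \<dots>, g (k - 1)\<close> is written as its Leibniz sum.
\<close>

definition minor ::
  "'a::comm_ring_1^'c^'r \<Rightarrow> nat \<Rightarrow> (nat \<Rightarrow> 'r) \<Rightarrow> (nat \<Rightarrow> 'c) \<Rightarrow> 'a" where
  "minor M k f g =
     (\<Sum>q | q permutes {..<k}. of_int (sign q) * (\<Prod>i<k. M $ f i $ g (q i)))"

definition zero_polynomial ::
  "real^'n^'n \<Rightarrow> real^'m^'n \<Rightarrow> real^'n^'p \<Rightarrow> real^'m^'p \<Rightarrow> complex poly" where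
  "zero_polynomial A B C D =
     (let r = normal_rank A B C D
      in Gcd {minor (pencil_poly A B C D) r f g | f g. inj_on f {..<r} \<and> inj_on g {..<r}})"

definition algebraic_multiplicity ::
  "real^'n^'n \<Rightarrow> real^'m^'n \<Rightarrow> real^'n^'p \<Rightarrow> real^'m^'p \<Rightarrow> complex \<Rightarrow> nat" where
  "algebraic_multiplicity A B C D l = order l (zero_polynomial A B C D)"

subsection \<open>Subspaces\<close>

definition stabilizability_output_nulling ::
  "time_domain \<Rightarrow> real^'n^'n \<Rightarrow> real^'m^'n \<Rightarrow> real^'n^'p \<Rightarrow> real^'m^'p \<Rightarrow> (real^'n) set \<Rightarrow> bool" where
  "stabilizability_output_nulling td A B C D V \<longleftrightarrow>
     subspace V \<and>
     (\<exists>F :: real^'n^'m.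
        (\<lambda>x. (A + B ** F) *v x) ` V \<subseteq> V \<and>
        V \<subseteq> {x. (C + D ** F) *v x = 0} \<and>
        spectrum_on (A + B ** F) V \<subseteq> stability_region td)"

definition V_star_g ::
  "time_domain \<Rightarrow> real^'n^'n \<Rightarrow> real^'m^'n \<Rightarrow> real^'n^'p \<Rightarrow> real^'m^'p \<Rightarrow> (real^'n) set" where
  "V_star_g td A B C D = (GREATEST V. stabilizability_output_nulling td A B C D V)"

definition L_generators ::
  "time_domain \<Rightarrow> real^'n^'n \<Rightarrow> real^'m^'n \<Rightarrow> real^'n^'p \<Rightarrow> real^'m^'p \<Rightarrow> 'p \<Rightarrow> (real^'n) set" where
  "L_generators td A B C D i =
     {v. \<exists>l \<in> real_stability_region td. \<exists>w :: real^'m. \<exists>d :: real. d \<noteq> 0 \<and>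
        (A - mat l) *v v + B *v w = 0 \<and> C *v v + D *v w = d *\<^sub>R axis i 1}"

definition L_space ::
  "time_domain \<Rightarrow> real^'n^'n \<Rightarrow> real^'m^'n \<Rightarrow> real^'n^'p \<Rightarrow> real^'m^'p \<Rightarrow> 'p \<Rightarrow> (real^'n) set" where
  "L_space td A B C D i = span (L_generators td A B C D i)"

subsection \<open>The control problem\<close>

definition static_gain ::
  "time_domain \<Rightarrow> real^'n^'n \<Rightarrow> real^'m^'n \<Rightarrow> real^'n^'p \<Rightarrow> real^'m^'p \<Rightarrow> real^'n^'m \<Rightarrow> real^'m^'p" where
  "static_gain td A B C D F =
     (C + D ** F) ** matrix_inv (mat (static_frequency td) - (A + B ** F)) ** B + D"

text \<open>Tracking of every constant reference under \<open>u = F x + G r\<close>, from every initial state.\<close>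

fun tracks_constants ::
  "time_domain \<Rightarrow> real^'n^'n \<Rightarrow> real^'m^'n \<Rightarrow> real^'n^'p \<Rightarrow> real^'m^'p \<Rightarrow> real^'n^'m \<Rightarrow> real^'p^'m
   \<Rightarrow> bool" where
  "tracks_constants Continuous A B C D F G \<longleftrightarrow>
     (\<forall>(r :: real^'p) (x :: real \<Rightarrow> real^'n) (u :: real \<Rightarrow> real^'m).
        (\<forall>t\<ge>0. u t = F *v x t + G *v r) \<longrightarrow>
        (\<forall>t\<ge>0. (x has_vector_derivative (A *v x t + B *v u t)) (at t within {0..})) \<longrightarrow>
        ((\<lambda>t. C *v x t + D *v u t) \<longlongrightarrow> r) at_top)"
| "tracks_constants Discrete A B C D F G \<longleftrightarrow>
     (\<forall>(r :: real^'p) (x :: nat \<Rightarrow> real^'n) (u :: nat \<Rightarrow> real^'m).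
        (\<forall>t. u t = F *v x t + G *v r) \<longrightarrow>
        (\<forall>t. x (Suc t) = A *v x t + B *v u t) \<longrightarrow>
        (\<lambda>t. C *v x t + D *v u t) \<longlonglongrightarrow> r)"

text \<open>
  State-to-output decoupling with \<open>\<mu> (Some i)\<close> closed-loop eigenvalues observable from the \<open>i\<close>-th
  component of the tracking error and \<open>\<mu> None\<close> unobservable ones, counted with multiplicity; all
  eigenvalues are real. The indexed family \<open>v\<close> is a basis of eigenvectors of \<open>A + B F\<close>.
\<close>

definition state_output_decoupled ::
  "real^'n^'n \<Rightarrow> real^'m^'n \<Rightarrow> real^'n^'p \<Rightarrow> real^'m^'p \<Rightarrow> real^'n^'m \<Rightarrow> ('p option \<Rightarrow> nat) \<Rightarrow> bool" where
  "state_output_decoupled A B C D F \<mu> \<longleftrightarrow>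
     (\<exists>(v :: 'p option \<Rightarrow> nat \<Rightarrow> real^'n) (l :: 'p option \<Rightarrow> nat \<Rightarrow> real).
        let J = (SIGMA k:UNIV. {..<\<mu> k}) in
        inj_on (\<lambda>(k, j). v k j) J \<and>
        independent ((\<lambda>(k, j). v k j) ` J) \<and>
        span ((\<lambda>(k, j). v k j) ` J) = UNIV \<and>
        (\<forall>k. \<forall>j<\<mu> k. (A + B ** F) *v v k j = l k j *\<^sub>R v k j) \<and>
        (\<forall>j<\<mu> None. (C + D ** F) *v v None j = 0) \<and>
        (\<forall>i. \<forall>j<\<mu> (Some i). \<exists>d. d \<noteq> 0 \<and> (C + D ** F) *v v (Some i) j = d *\<^sub>R axis i 1))"

definition problem_2C_solvable ::
  "time_domain \<Rightarrow> real^'n^'n \<Rightarrow> real^'m^'n \<Rightarrow> real^'n^'p \<Rightarrow> real^'m^'p \<Rightarrow> ('p \<Rightarrow> nat) \<Rightarrow> bool" where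
  "problem_2C_solvable td A B C D \<nu> \<longleftrightarrow>
     (\<exists>(F :: real^'n^'m) (G :: real^'p^'m).
        stabilizing td A B F \<and>
        static_gain td A B C D F ** G = mat 1 \<and>
        tracks_constants td A B C D F G \<and>
        state_output_decoupled A B C D F
          (\<lambda>k. case k of None \<Rightarrow> CARD('n) - (\<Sum>i\<in>UNIV. \<nu> i) | Some i \<Rightarrow> \<nu> i))"

end

theory Submission
  imports Defs
begin

text \<open>
  Call \<open>v\<close> a null direction if \<open>(A - \<lambda>) v + B w = 0\<close> and \<open>C v + D w = 0\<close> for a real stable \<open>\<lambda>\<close> and some
  \<open>w\<close>. A decoupling feedback is the same as a basis of \<open>\<real>\<^sup>n\<close> made of \<open>\<nu>\<^sub>0\<close> null directions and \<open>\<nu>\<^sub>i\<close>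
  generators of each \<open>L\<^sub>i\<close>, and Rado's theorem says when an independent family of this shape
  exists. What remains is that the null directions span \<open>V\<^sup>*\<^sub>g\<close>.

  Let \<open>\<phi>\<close> be a functional that vanishes on all null directions and \<open>x\<close> an element of an output-nulling
  subspace, invariant under \<open>M = A + B F\<close> with stable spectrum there. With \<open>a\<close> the minimal polynomial of
  \<open>M\<close> at \<open>x\<close>, there is a polynomial solution \<open>y\<close> of \<open>(M - \<lambda>) y(\<lambda>) = - a(\<lambda>) x\<close>. Comparing it with a
  right inverse of the system pencil expresses \<open>\<phi> y\<close> as \<open>a\<close> times a rational function, which has no
  pole at a root \<open>\<mu>\<close> of \<open>a\<close>: if \<open>\<mu>\<close> is not a zero of the system, the pencil is onto at \<open>\<mu>\<close>; if it is,
  equality of the multiplicities makes the pole of the right inverse simple, with residue in the kernel of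
  the pencil at \<open>\<mu>\<close>, where \<open>\<phi>\<close> vanishes. So \<open>a\<close> divides \<open>\<phi> y\<close>, whose degree is smaller, and \<open>\<phi> x = 0\<close>.
\<close>

subsection \<open>Polynomial matrices\<close>

definition eval_mat :: "'a::comm_ring_1 poly^'c^'r \<Rightarrow> 'a \<Rightarrow> 'a^'c^'r" where
  "eval_mat M l = (\<chi> i j. poly (M $ i $ j) l)"

lemma poly_det: "poly (det M) l = det (eval_mat M l)"
  for M :: "'a::{comm_ring_1} poly^'n^'n"
proof -
  have "poly (of_int k) l = (of_int k :: 'a)" for k
    by (cases k rule: int_cases2) auto
  then show ?thesis
    by (simp add: det_def poly_sum poly_prod eval_mat_def)
qed

lemma eval_mat_mult: "eval_mat (M ** N) l = eval_mat M l ** eval_mat N l"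
  by (simp add: eval_mat_def matrix_matrix_mult_def vec_eq_iff poly_sum)

lemma poly_eq_if_agree_infinitely:
  fixes p q :: "'a::idom poly"
  assumes "infinite S" and "\<And>x. x \<in> S \<Longrightarrow> poly p x = poly q x"
  shows "p = q"
proof (rule ccontr)
  assume "p \<noteq> q"
  then have "finite {x. poly (p - q) x = 0}"
    by (intro poly_roots_finite) auto
  moreover have "S \<subseteq> {x. poly (p - q) x = 0}"
    using assms(2) by auto
  ultimately show False
    using assms(1) finite_subset by blast
qed

lemma poly_eq_if_agree_cofinitely:
  fixes p q d :: "'a::{idom,ring_char_0} poly"
  assumes "d \<noteq> 0" and "\<And>x. poly d x \<noteq> 0 \<Longrightarrow> poly p x = poly q x"
  shows "p = q"
proof (rule poly_eq_if_agree_infinitely)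
  have "finite {x. poly d x = 0}"
    using assms(1) by (rule poly_roots_finite)
  then show "infinite {x. poly d x \<noteq> 0}"
    using infinite_UNIV_char_0 finite_Collect_not by blast
qed (use assms(2) in auto)

text \<open>Cramer's rule solves the system at every point where the determinant does not vanish.
  Both sides are polynomial, so agreement off the finitely many roots of \<open>det M\<close> is
  enough. The vector of determinants is the adjugate of \<open>M\<close> applied to
  \<open>b\<close>.\<close>

lemma adjugate_solution:
  fixes M :: "'a::field_char_0 poly^'n^'n" and b :: "'a poly^'n"
  assumes "det M \<noteq> 0"
  shows "M *v (\<chi> k. det (\<chi> i j. if j = k then b $ i else M $ i $ j)) = det M *s b"
proof -
  let ?q = "\<chi> k. det (\<chi> i j. if j = k then b $ i else M $ i $ j)"
  have "(M *v ?q) $ i = (det M *s b) $ i" for i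
  proof (rule poly_eq_if_agree_cofinitely[OF assms])
    fix x
    assume nz: "poly (det M) x \<noteq> 0"
    define Mx where "Mx = eval_mat M x"
    define bx where "bx = (\<chi> i. poly (b $ i) x)"
    have dx: "det Mx \<noteq> 0" and dM: "poly (det M) x = det Mx"
      using nz by (simp_all add: poly_det Mx_def)
    have q: "poly (?q $ k) x = det (\<chi> i j. if j = k then bx $ i else Mx $ i $ j)" for k
      by (simp add: poly_det bx_def Mx_def eval_mat_def if_distrib[of "\<lambda>p. poly p x"] cong: if_cong)
    have "Mx *v (\<chi> k. det (\<chi> i j. if j = k then bx $ i else Mx $ i $ j) / det Mx) = bx"
      using cramer[OF dx] by blast
    then have "(\<Sum>k\<in>UNIV. Mx $ i $ k * (poly (?q $ k) x / det Mx)) = bx $ i"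
      unfolding q by (simp add: matrix_vector_mult_def vec_eq_iff)
    then have "(\<Sum>k\<in>UNIV. Mx $ i $ k * poly (?q $ k) x) = det Mx * bx $ i"
      using dx by (simp add: field_simps flip: sum_divide_distrib)
    then show "poly ((M *v ?q) $ i) x = poly ((det M *s b) $ i) x"
      unfolding dM[symmetric]
      by (simp add: matrix_vector_mult_def poly_sum Mx_def eval_mat_def bx_def)
  qed
  then show ?thesis
    by (simp add: vec_eq_iff)
qed

section \<open>Ranks, left kernels and column selection over a field\<close>

lemma card_basis_vec:
  fixes E :: "('a::field^'n) set"
  assumes "vec.independent E" "vec.span E = UNIV"
  shows "card E = CARD('n)"
proof -
  have "vec.dim (UNIV :: ('a^'n) set) = card E"
    using vec.dim_eq_card_independent[OF assms(1)] vec.dim_span[of E] unfolding assms(2) by metis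
  then show ?thesis
    by (metis vec_dim_card)
qed

text \<open>A basis of the left kernel extends to a basis of the whole space. The added vectors are
  mapped injectively into the row space, because a combination of them in the kernel would have two
  disjoint basis representations.\<close>

lemma left_kernel_rank:
  fixes S :: "'a::field^'c^'r"
  shows "CARD('r) \<le> vec.dim {k. k v* S = 0} + rank S"
proof -
  let ?f = "\<lambda>k. k v* S"
  let ?K = "{k. k v* S = 0}"
  have lin: "Vector_Spaces.linear (*s) (*s) ?f"
    unfolding transpose_matrix_vector[symmetric] by (rule matrix_vector_mul_linear_gen)
  interpret f: Vector_Spaces.linear "(*s)" "(*s)" ?f by (rule lin)
  have subK: "vec.subspace ?K"
    by (rule f.subspace_kernel)
  obtain BL where BL: "BL \<subseteq> ?K" "vec.independent BL" "?K \<subseteq> vec.span BL" "card BL = vec.dim ?K"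
    using vec.basis_exists by blast
  define E where "E = vec.extend_basis BL"
  have E: "BL \<subseteq> E" "vec.independent E" "vec.span E = UNIV"
    using vec.extend_basis_superset[OF BL(2)] vec.independent_extend_basis[OF BL(2)]
      vec.span_extend_basis[OF BL(2)] by (auto simp: E_def)
  have finE: "finite E"
    using E(2) by (rule vec.finiteI_independent)
  have cardE: "card E = CARD('r)"
    by (rule card_basis_vec[OF E(2,3)])
  have indC: "vec.independent (E - BL)"
    using E(2) by (rule vec.independent_mono) auto
  have "inj_on ?f (vec.span (E - BL))"
  proof (subst f.inj_on_iff_eq_0)
    show "vec.subspace (vec.span (E - BL))" by simp
    show "\<forall>x\<in>vec.span (E - BL). ?f x = 0 \<longrightarrow> x = 0"
    proof safe
      fix x assume x: "x \<in> vec.span (E - BL)" "?f x = 0"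
      then have "x \<in> vec.span BL" using BL(3) by auto
      then have "vec.representation E x = vec.representation BL x"
        using vec.representation_extend[OF E(2) _ E(1)] by simp
      moreover have "vec.representation E x = vec.representation (E - BL) x"
        using vec.representation_extend[OF E(2) x(1)] by simp
      ultimately have "vec.representation E x e = 0" for e
        using vec.representation_ne_zero[of BL x e] vec.representation_ne_zero[of "E - BL" x e]
        by auto
      then show "x = 0"
        using vec.sum_nonzero_representation_eq[OF E(2), of x] by (simp add: E(3))
    qed
  qed
  then have "vec.dim (?f ` (E - BL)) = vec.dim (E - BL)"
    by (rule vec.dim_image_eq[OF lin])
  also have "\<dots> = card E - card BL"
    using vec.dim_eq_card_independent[OF indC] card_Diff_subset[OF finite_subset[OF E(1) finE] E(1)] by simp
  finally have "CARD('r) - vec.dim ?K = vec.dim (?f ` (E - BL))"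
    by (simp add: cardE BL)
  also have "\<dots> \<le> vec.dim (vec.span (rows S))"
  proof (rule vec.dim_subset)
    have "k v* S \<in> vec.span (rows S)" for k
      using matrix_vector_mult_in_columnspace_gen[of "transpose S" k] by simp
    then show "?f ` (E - BL) \<subseteq> vec.span (rows S)" by auto
  qed
  finally show ?thesis
    by (simp add: row_rank_def_gen)
qed

text \<open>Independent vectors of the left kernel, completed to a basis, serve as the rows of
  \<open>U\<close>; each of them contributes a zero row of the product.\<close>

lemma row_reduction_zero_rows:
  fixes S :: "'a::field^'c^'r"
  obtains U :: "'a^'r^'r" and Z :: "'r set"
  where "det U \<noteq> 0" "card Z = CARD('r) - rank S" "\<And>i. i \<in> Z \<Longrightarrow> (U ** S) $ i = 0"
proof -
  let ?L = "{k. k v* S = 0}"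
  obtain BL where BL: "BL \<subseteq> ?L" "vec.independent BL" "?L \<subseteq> vec.span BL" "card BL = vec.dim ?L"
    using vec.basis_exists[of ?L] by blast
  have "CARD('r) - rank S \<le> card BL"
    using left_kernel_rank[of S] BL(4) by simp
  \<comment> \<open>\<open>left_kernel_rank\<close> bounds the dimension only from below, hence the
    passage to a subset of exactly the required size.\<close>
  then obtain K where K: "K \<subseteq> BL" "card K = CARD('r) - rank S"
    using obtain_subset_with_card_n by metis
  have indK: "vec.independent K"
    using BL(2) K(1) by (rule vec.independent_mono)
  define E where "E = vec.extend_basis K"
  have E: "K \<subseteq> E" "vec.independent E" "vec.span E = UNIV"
    using vec.extend_basis_superset[OF indK] vec.independent_extend_basis[OF indK]
      vec.span_extend_basis[OF indK] by (auto simp: E_def)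
  have "finite E"
    using E(2) by (rule vec.finiteI_independent)
  moreover have "card E = CARD('r)"
    by (rule card_basis_vec[OF E(2,3)])
  ultimately obtain u where u: "bij_betw u (UNIV :: 'r set) E"
    using finite_same_card_bij[OF finite_class.finite_UNIV] by metis
  define U where "U = (\<chi> i. u i)"
  have "rows U = E"
    using u by (auto simp: rows_def row_def U_def bij_betw_def vec_lambda_eta)
  then have "det U \<noteq> 0"
    using matrix_left_invertible_span_rows_gen[of U] E(3)
    by (metis invertible_det_nz invertible_left_inverse)
  moreover have "card {i. u i \<in> K} = card K"
  proof -
    have "u ` {i. u i \<in> K} = K"
      using u E(1) by (auto simp: bij_betw_def)
    then show ?thesis
      using card_image[of u "{i. u i \<in> K}"] u by (metis bij_betw_def inj_on_subset subset_UNIV)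
  qed
  moreover have "(U ** S) $ i = 0" if "u i \<in> K" for i
  proof -
    have "(U ** S) $ i = u i v* S"
      by (simp add: U_def matrix_matrix_mult_def vector_matrix_mult_def vec_eq_iff mult.commute)
    then show ?thesis
      using that K(1) BL(1) by auto
  qed
  ultimately show ?thesis
    using that[of U "{i. u i \<in> K}"] K(2) by simp
qed

text \<open>Indexing the chosen columns by the row type keeps the submatrix square, so that
  \<open>det\<close> applies. For injective \<open>h\<close> its determinant is a maximal minor up
  to sign.\<close>

definition select_columns :: "'a^'c^'r \<Rightarrow> ('r \<Rightarrow> 'c) \<Rightarrow> 'a^'r^'r" where
  "select_columns M h = (\<chi> i j. M $ i $ h j)"

lemma select_columns_mult: "select_columns (U ** M) h = U ** select_columns M h"
  by (simp add: select_columns_def matrix_matrix_mult_def)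

lemma eval_mat_select_columns: "eval_mat (select_columns M h) l = select_columns (eval_mat M l) h"
  by (simp add: select_columns_def eval_mat_def)

lemma mult_extend_by_zero:
  fixes M :: "'a::comm_semiring_1^'c^'r"
  assumes "inj h"
  shows "M *v (\<chi> c. if c \<in> range h then q $ inv h c else 0) = select_columns M h *v q"
proof -
  have "(\<Sum>c\<in>UNIV. M $ i $ c * (if c \<in> range h then q $ inv h c else 0))
      = (\<Sum>c\<in>range h. M $ i $ c * q $ inv h c)" for i
    by (rule sum.mono_neutral_cong_right) auto
  also have "(\<Sum>c\<in>range h. M $ i $ c * q $ inv h c) = (\<Sum>j\<in>UNIV. M $ i $ h j * q $ j)" for i
    by (subst sum.reindex[OF assms]) (simp add: inv_f_f[OF assms])
  finally show ?thesis
    by (simp add: matrix_vector_mult_def select_columns_def vec_eq_iff)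
qed

lemma full_row_rank_select_columns:
  fixes M :: "'a::field^'c^'r"
  assumes "surj ((*v) M)"
  obtains h where "inj h" "det (select_columns M h) \<noteq> 0"
proof -
  have "vec.span (columns M) = UNIV"
    using assms matrix_right_invertible_surjective matrix_right_invertible_span_columns by blast
  then obtain E where E: "E \<subseteq> columns M" "vec.independent E" "vec.span E = UNIV"
    using vec.maximal_independent_subset[of "columns M"] vec.span_minimal[of "columns M"]
    by (metis top.extremum_uniqueI vec.subspace_span)
  have "finite E"
    using E(2) by (rule vec.finiteI_independent)
  moreover have "card E = CARD('r)"
    by (rule card_basis_vec[OF E(2,3)])
  ultimately obtain u where u: "bij_betw u (UNIV :: 'r set) E"
    using finite_same_card_bij[OF finite_class.finite_UNIV] by metis
  have "\<forall>i. \<exists>c. u i = column c M"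
    using u E(1) by (auto simp: bij_betw_def columns_def)
  then obtain h where h: "\<And>i. u i = column (h i) M"
    by metis
  have "inj h"
    using u h by (metis bij_betw_def injD injI)
  moreover have "columns (select_columns M h) = E"
    using u by (auto simp: columns_def column_def select_columns_def bij_betw_def h)
  then have "det (select_columns M h) \<noteq> 0"
    using matrix_right_invertible_span_columns[of "select_columns M h"] E(3)
    by (metis invertible_det_nz invertible_right_inverse)
  ultimately show ?thesis
    using that by blast
qed

lemma rank_le_rows: "rank M \<le> CARD('r)" for M :: "'a::field^'c^'r"
proof -
  have "rank M \<le> card (rows M)"
    unfolding row_rank_def_gen by (rule vec.dim_le_card') (simp add: rows_def full_SetCompr_eq)
  also have "\<dots> \<le> CARD('r)"
    unfolding rows_def using card_image_le[of UNIV "\<lambda>i. row i M"] by (simp add: full_SetCompr_eq)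
  finally show ?thesis .
qed

text \<open>Since \<open>rank\<close> is the dimension of the row space, full row rank means
  independence of the rows, which is dual to surjectivity. Conversely, independent rows leave a
  trivial left kernel, and \<open>left_kernel_rank\<close> gives the bound.\<close>

lemma surj_iff_full_row_rank:
  fixes M :: "'a::field^'c^'r"
  shows "surj ((*v) M) \<longleftrightarrow> rank M = CARD('r)"
proof
  assume "rank M = CARD('r)"
  then have dim: "vec.dim (rows M) = CARD('r)"
    by (simp add: row_rank_def_gen)
  have card: "card (rows M) \<le> CARD('r)"
    unfolding rows_def using card_image_le[of UNIV "\<lambda>i. row i M"] by (simp add: full_SetCompr_eq)
  have fin: "finite (rows M)"
    unfolding rows_def by (simp add: full_SetCompr_eq)
  have ind: "vec.independent (rows M)"
    using vec.card_le_dim_spanning[of "rows M" "rows M"] vec.span_superset[of "rows M"] fin card dim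
    by (simp add: vec.span_superset)
  have "card (rows M) = CARD('r)"
    using vec.dim_eq_card_independent[OF ind] dim by simp
  then have inj: "inj (\<lambda>i. row i M)"
    by (intro eq_card_imp_inj_on) (simp_all add: rows_def full_SetCompr_eq)
  have "c i = 0" if "(\<Sum>i\<in>UNIV. c i *s row i M) = 0" for c i
  proof -
    have "(\<Sum>v\<in>rows M. c (inv (\<lambda>i. row i M) v) *s v) = 0"
      using sum.reindex[OF inj, of "\<lambda>v. c (inv (\<lambda>i. row i M) v) *s v"]
      by (simp add: inv_f_f[OF inj] that rows_def full_SetCompr_eq)
    moreover have "row i M \<in> rows M"
      by (auto simp: rows_def)
    ultimately have "c (inv (\<lambda>i. row i M) (row i M)) = 0"
      using conjunct2[OF ind[unfolded vec.independent_explicit], rule_format,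
          of "\<lambda>v. c (inv (\<lambda>i. row i M) v)" "row i M"] by simp
    then show ?thesis
      by (simp add: inv_f_f[OF inj])
  qed
  then show "surj ((*v) M)"
    using matrix_right_invertible_independent_rows[of M] matrix_right_invertible_surjective[of M] by blast
next
  assume "surj ((*v) M)"
  then have "\<exists>B. M ** B = mat 1"
    using matrix_right_invertible_surjective by blast
  then have *: "(\<Sum>i\<in>UNIV. c i *s row i M) = 0 \<Longrightarrow> c i = 0" for c i
    using matrix_right_invertible_independent_rows[of M] by blast
  have "{k. k v* M = 0} = {0}"
  proof -
    have "k = 0" if "k v* M = 0" for k
    proof -
      have "(\<Sum>i\<in>UNIV. k $ i *s row i M) = 0"
        using that by (simp add: vector_matrix_mult_def row_def vec_eq_iff mult.commute)
      from *[OF this] show ?thesis by (simp add: vec_eq_iff)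
    qed
    then show ?thesis by auto
  qed
  then have "CARD('r) \<le> rank M"
    using left_kernel_rank[of M] by simp
  then show "rank M = CARD('r)"
    using rank_le_rows[of M] by simp
qed

text \<open>
  Row operations make \<open>g\<close> rows of \<open>M \<mu>\<close> vanish, where \<open>g\<close> is the rank deficiency. Dividing these rows
  by the linear factor removes exactly its \<open>g\<close>-th power from the minor, so that Cramer's rule applies
  at \<open>\<mu>\<close> to the divided matrix.
\<close>

lemma local_right_inverse:
  fixes M :: "'a::field_char_0 poly^'c^'r" and b :: "'a^'r"
  assumes h: "inj h"
    and ndvd: "\<not> [:-\<mu>, 1:] ^ Suc (CARD('r) - rank (eval_mat M \<mu>)) dvd det (select_columns M h)"
  obtains d :: "'a poly" and q :: "'a poly^'c"
  where "poly d \<mu> \<noteq> 0"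
    "\<And>l. eval_mat M l *v (\<chi> c. poly (q $ c) l) = ((l - \<mu>) * poly d l) *s b"
    "\<And>c. rank (eval_mat M \<mu>) = CARD('r) \<Longrightarrow> poly (q $ c) \<mu> = 0"
proof -
  let ?t = "[:-\<mu>, 1:]"
  let ?g = "CARD('r) - rank (eval_mat M \<mu>)"
  obtain U Z where U: "det U \<noteq> 0" "card Z = ?g" "\<And>i. i \<in> Z \<Longrightarrow> (U ** eval_mat M \<mu>) $ i = 0"
    using row_reduction_zero_rows[of "eval_mat M \<mu>"] by metis
  define Up where "Up = map_matrix (\<lambda>x. [:x:]) U"
  have eval_Up: "eval_mat Up l = U" for l
    by (simp add: Up_def eval_mat_def map_matrix_def vec_eq_iff)
  define c where "c i = (if i \<in> Z then ?t else 1)" for i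
  define M' where "M' = (\<chi> i j. (Up ** M) $ i $ j div c i)"
  have eq: "(Up ** M) $ i $ j = c i * M' $ i $ j" for i j
  proof (cases "i \<in> Z")
    case True
    have "poly ((Up ** M) $ i $ j) \<mu> = (U ** eval_mat M \<mu>) $ i $ j"
      using eval_mat_mult[of Up M \<mu>] by (simp add: eval_Up) (simp add: eval_mat_def vec_eq_iff)
    then have "?t dvd (Up ** M) $ i $ j"
      using U(3)[OF True] by (simp add: poly_eq_0_iff_dvd)
    then show ?thesis
      using True by (simp add: M'_def c_def del: mult_pCons_left)
  qed (simp add: M'_def c_def)
  define S where "S = select_columns M' h"
  have S: "select_columns (Up ** M) h = (\<chi> i. c i *s S $ i)"
    by (simp add: select_columns_def S_def vec_eq_iff eq)
  have "det (select_columns (Up ** M) h) = (\<Prod>i\<in>UNIV. c i) * det S"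
    unfolding S by (subst det_rows_mul) (simp add: vec_lambda_eta)
  also have "(\<Prod>i\<in>UNIV. c i) = ?t ^ ?g"
    using U(2) by (simp add: c_def prod.If_cases)
  finally have det_eq: "det Up * det (select_columns M h) = ?t ^ ?g * det S"
    by (simp add: select_columns_mult det_mul)
  have "is_unit (det Up)"
  proof -
    have "det Up = [:det U:]"
      by (rule poly_eq_if_agree_infinitely[OF infinite_UNIV_char_0]) (simp add: poly_det eval_Up)
    then show ?thesis
      using U(1) by (simp add: is_unit_const_poly_iff dvd_field_iff)
  qed
  have detS: "poly (det S) \<mu> \<noteq> 0"
  proof
    assume "poly (det S) \<mu> = 0"
    then have "?t dvd det S"
      by (simp add: poly_eq_0_iff_dvd)
    then have "?t ^ Suc ?g dvd det Up * det (select_columns M h)"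
      unfolding det_eq power_Suc2 by (intro mult_dvd_mono dvd_refl)
    then show False
      using ndvd \<open>is_unit (det Up)\<close> by (simp add: dvd_mult_unit_iff')
  qed
  \<comment> \<open>Rows in \<open>Z\<close> were divided by \<open>?t\<close> and the others were
    not. The entries of \<open>b'\<close> outside \<open>Z\<close> receive the missing factor, so
    that \<open>c i * b' $ i\<close> carries exactly one factor \<open>?t\<close> in every
    row.\<close>
  define b' where "b' = (\<chi> i. (if i \<in> Z then 1 else ?t) * [:(U *v b) $ i:])"
  define q' where "q' = (\<chi> k. det (\<chi> i j. if j = k then b' $ i else S $ i $ j))"
  have Sq: "S *v q' = det S *s b'"
    unfolding q'_def by (rule adjugate_solution) (use detS in auto)
  have inv: "select_columns (eval_mat M l) h *v (\<chi> j. poly (q' $ j) l) = ((l - \<mu>) * poly (det S) l) *s b" for l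
  proof -
    let ?x = "select_columns (eval_mat M l) h *v (\<chi> j. poly (q' $ j) l)"
    have "(U *v ?x) $ i = (U *v (((l - \<mu>) * poly (det S) l) *s b)) $ i" for i
    proof -
      have "U *v ?x = eval_mat (select_columns (Up ** M) h) l *v (\<chi> j. poly (q' $ j) l)"
        by (simp add: matrix_vector_mul_assoc eval_mat_select_columns eval_mat_mult eval_Up select_columns_mult)
      then have "(U *v ?x) $ i = poly (c i) l * poly ((S *v q') $ i) l"
        unfolding S by (simp add: matrix_vector_mult_def eval_mat_def poly_sum sum_distrib_left mult.assoc)
      also have "\<dots> = poly (c i) l * poly (b' $ i) l * poly (det S) l"
        by (simp add: Sq)
      also have "poly (c i) l * poly (b' $ i) l = (l - \<mu>) * (U *v b) $ i"
        by (simp add: c_def b'_def)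
      also have "\<dots> * poly (det S) l = (U *v (((l - \<mu>) * poly (det S) l) *s b)) $ i"
        by (simp add: vec.scale)
      finally show ?thesis .
    qed
    then have "U *v ?x = U *v (((l - \<mu>) * poly (det S) l) *s b)"
      by (simp add: vec_eq_iff)
    moreover have "inj ((*v) U)"
      using U(1) by (simp add: inj_matrix_vector_mult invertible_det_nz)
    ultimately show ?thesis
      by (simp add: inj_eq)
  qed
  define q where "q = (\<chi> k. if k \<in> range h then q' $ inv h k else 0)"
  have "(\<chi> k. poly (q $ k) l) = (\<chi> k. if k \<in> range h then (\<chi> j. poly (q' $ j) l) $ inv h k else 0)" for l
    by (simp add: q_def vec_eq_iff)
  then have 1: "eval_mat M l *v (\<chi> k. poly (q $ k) l) = ((l - \<mu>) * poly (det S) l) *s b" for l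
    using mult_extend_by_zero[OF h, of "eval_mat M l" "\<chi> j. poly (q' $ j) l"] inv[of l] by simp
  have 2: "poly (q $ k) \<mu> = 0" if full: "rank (eval_mat M \<mu>) = CARD('r)" for k
  proof -
    \<comment> \<open>At full rank no row is divided, so all of \<open>b'\<close> vanishes at \<mu>,
      and with it the replaced column of every Cramer determinant.\<close>
    have "Z = {}"
      using U(2) full by simp
    then have "poly (b' $ i) \<mu> = 0" for i
      by (simp add: b'_def)
    then have col: "column j (eval_mat (\<chi> i k. if k = j then b' $ i else S $ i $ k) \<mu>) = 0" for j
      by (simp add: column_def eval_mat_def vec_eq_iff)
    have "poly (q' $ j) \<mu> = 0" for j
      unfolding q'_def using det_zero_column(1)[OF col[of j]] by (simp add: poly_det)
    then show ?thesis
      by (simp add: q_def)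
  qed
  show ?thesis
    using that[of "det S" q] detS 1 2 by blast
qed

text \<open>Being injective, \<open>f\<close> enumerates all rows, so conjugation by
  \<open>f\<close> matches the permutations of the index range with those of the row type. It
  preserves signs, and the two Leibniz sums agree term by term.\<close>

lemma minor_eq_det:
  fixes M :: "'a::comm_ring_1^'c^'r"
  assumes f: "inj_on f {..<CARD('r)}"
  shows "minor M CARD('r) f g = det (select_columns M (g \<circ> inv_into {..<CARD('r)} f))"
proof -
  let ?N = "{..<CARD('r)}"
  have im: "f ` ?N = UNIV"
    using card_image[OF f] by (simp add: card_eq_UNIV_imp_eq_UNIV)
  then have bij: "bij_betw f ?N UNIV"
    using f by (simp add: bij_betw_def)
  let ?e = "map_permutation ?N f"
  have bijp: "bij_betw ?e {q. q permutes ?N} {p. p permutes (UNIV :: 'r set)}"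
  proof (rule bij_betw_byWitness[where f' = "map_permutation UNIV (inv_into ?N f)"])
    have inv: "bij_betw (inv_into ?N f) UNIV ?N"
      by (rule bij_betw_inv_into[OF bij])
    show "\<forall>q\<in>{q. q permutes ?N}. map_permutation UNIV (inv_into ?N f) (?e q) = q"
      by (auto intro!: map_permutation_compose_inv[OF bij] simp: f)
    show "\<forall>p\<in>{p. p permutes UNIV}. ?e (map_permutation UNIV (inv_into ?N f) p) = p"
      by (auto intro!: map_permutation_compose_inv[OF inv] simp: f_inv_into_f im)
    show "?e ` {q. q permutes ?N} \<subseteq> {p. p permutes UNIV}"
      using map_permutation_permutes[OF bij] by auto
    show "map_permutation UNIV (inv_into ?N f) ` {p. p permutes UNIV} \<subseteq> {q. q permutes ?N}"
      using map_permutation_permutes[OF inv] by auto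
  qed
  have "(\<Prod>i\<in>UNIV. M $ i $ g (inv_into ?N f (?e q i))) = (\<Prod>i\<in>?N. M $ f i $ g (q i))"
    if "q permutes ?N" for q
  proof -
    have "(\<Prod>i\<in>UNIV. M $ i $ g (inv_into ?N f (?e q i))) = (\<Prod>i\<in>?N. M $ f i $ g (inv_into ?N f (?e q (f i))))"
      using prod.reindex_bij_betw[OF bij, of "\<lambda>i. M $ i $ g (inv_into ?N f (?e q i))"] by simp
    also have "\<dots> = (\<Prod>i\<in>?N. M $ f i $ g (q i))"
    proof (rule prod.cong)
      fix i assume i: "i \<in> ?N"
      then have "inv_into ?N f (?e q (f i)) = q i"
        using map_permutation_apply[OF f i, of q] permutes_in_image[OF that, of i] inv_into_f_f[OF f] by simp
      then show "M $ f i $ g (inv_into ?N f (?e q (f i))) = M $ f i $ g (q i)" by simp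
    qed simp
    finally show ?thesis .
  qed
  then show ?thesis
    unfolding minor_def det_def
    by (subst sum.reindex_bij_betw[OF bijp, symmetric])
       (auto simp: select_columns_def sign_map_permutation[OF f] intro!: sum.cong)
qed

subsection \<open>Krylov combinations\<close>

text \<open>This is p(M) x, evaluated by Horner's rule.\<close>

definition krylov :: "'a::field^'n^'n \<Rightarrow> 'a poly \<Rightarrow> 'a^'n \<Rightarrow> 'a^'n" where
  "krylov M p x = fold_coeffs (\<lambda>a y. a *s x + M *v y) p 0"

lemma krylov_0 [simp]: "krylov M 0 x = 0"
  by (simp add: krylov_def)

lemma krylov_pCons [simp]: "krylov M (pCons a p) x = a *s x + M *v krylov M p x"
  by (cases "p = 0 \<and> a = 0") (auto simp add: krylov_def)

lemma krylov_add: "krylov M (p + q) x = krylov M p x + krylov M q x"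
  by (induction p q rule: poly_induct2) (simp_all add: vec.add vec.scale_left_distrib)

lemma krylov_smult: "krylov M (smult c p) x = c *s krylov M p x"
  by (induction p) (simp_all add: vec.scale vec.scale_right_distrib)

lemma krylov_diff: "krylov M (p - q) x = krylov M p x - krylov M q x"
  using krylov_add[of M "p - q" q x] by simp

lemma krylov_linear_factor:
  "krylov M ([:-l, 1:] * q) x = M *v krylov M q x - l *s krylov M q x"
  by (simp add: krylov_add krylov_diff krylov_smult)

lemma krylov_in_subspace:
  assumes "vec.subspace W" "\<And>y. y \<in> W \<Longrightarrow> M *v y \<in> W" "x \<in> W"
  shows "krylov M p x \<in> W"
  by (induction p)
     (use assms in \<open>simp_all add: vec.subspace_0 vec.subspace_add vec.subspace_scale\<close>)

text \<open>The vectors x, M x, M^2 x, ... cannot all be independent of their predecessors in a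
  space of finite dimension, so some power depends on the lower ones.\<close>

lemma annihilating_polynomial_exists:
  fixes M :: "'a::field^'n^'n"
  obtains a where "a \<noteq> 0" "krylov M a x = 0"
proof -
  let ?m = "\<lambda>k. krylov M (monom 1 k) x"
  have "\<exists>k. ?m k \<in> vec.span (?m ` {..<k})"
  proof (rule ccontr)
    assume "\<not> ?thesis"
    then have notin: "?m k \<notin> vec.span (?m ` {..<k})" for k
      by blast
    have "vec.independent (?m ` {..<k}) \<and> card (?m ` {..<k}) = k" for k
    proof (induction k)
      case (Suc k)
      have "?m k \<notin> ?m ` {..<k}"
        using notin[of k] vec.span_base[of "?m k" "?m ` {..<k}"] by auto
      then show ?case
        using Suc notin[of k] by (simp add: lessThan_Suc vec.independent_insert)
    qed (simp add: vec.independent_empty)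
    then have "vec.independent (?m ` {..<Suc CARD('n)})" "card (?m ` {..<Suc CARD('n)}) = Suc CARD('n)"
      by blast+
    moreover have "card (?m ` {..<Suc CARD('n)}) \<le> CARD('n)"
      using vec.independent_card_le_dim[OF subset_UNIV calculation(1)] by (simp only: vec_dim_card)
    ultimately show False by linarith
  qed
  then obtain k where k: "?m k \<in> vec.span (?m ` {..<k})" ..
  \<comment> \<open>Combinations of degree below \<open>k\<close> form a subspace containing the
    lower powers, so the dependence reads M^k x = p(M) x with such a \<open>p\<close>. The
    coefficient 1 at \<open>k\<close> keeps \<open>monom 1 k - p\<close> from being zero.\<close>
  let ?T = "{krylov M p x |p. \<forall>i\<ge>k. coeff p i = 0}"
  have "vec.span (?m ` {..<k}) \<subseteq> ?T"
  proof (rule vec.span_minimal)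
    show "?m ` {..<k} \<subseteq> ?T"
      by (auto intro!: exI[of _ "monom 1 _"])
    show "vec.subspace ?T"
    proof (rule vec.subspaceI)
      show "0 \<in> ?T" by (auto intro!: exI[of _ 0])
    next
      fix y z assume "y \<in> ?T" "z \<in> ?T"
      then obtain p q where "y = krylov M p x" "z = krylov M q x" "\<forall>i\<ge>k. coeff p i = 0" "\<forall>i\<ge>k. coeff q i = 0"
        by blast
      then show "y + z \<in> ?T"
        by (auto simp: krylov_add intro!: exI[of _ "p + q"])
    next
      fix c y assume "y \<in> ?T"
      then obtain p where "y = krylov M p x" "\<forall>i\<ge>k. coeff p i = 0"
        by blast
      then show "c *s y \<in> ?T"
        by (auto simp: krylov_smult intro!: exI[of _ "smult c p"])
    qed
  qed
  with k obtain p where p: "?m k = krylov M p x" "\<forall>i\<ge>k. coeff p i = 0"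
    by blast
  have "coeff (monom 1 k - p) k = 1"
    using p(2) by simp
  then have "monom 1 k - p \<noteq> 0"
    by (metis coeff_0 zero_neq_one)
  moreover have "krylov M (monom 1 k - p) x = 0"
    using p(1) by (simp add: krylov_diff)
  ultimately show ?thesis
    using that by blast
qed

text \<open>The vector is (p(M) - p(l)) / (M - l) x, which is polynomial in \<open>l\<close>.
  Prepending a coefficient to \<open>p\<close> adds p(l) x and applies \<open>M\<close> to the rest,
  so the induction runs over all functionals: \<open>M\<close> is absorbed into
  \<open>f\<close>.\<close>

lemma functional_of_resolvent_polynomial:
  fixes M :: "'a::field^'n^'n" and f :: "'a^'n \<Rightarrow> 'a"
  assumes "\<And>x y. f (x + y) = f x + f y" and "\<And>c x. f (c *s x) = c * f x"
  obtains h where "\<And>l. poly h l = f (krylov M (synthetic_div p l) x)"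
    and "\<And>k. degree p \<le> k \<Longrightarrow> coeff h k = 0"
    and "degree p > 0 \<Longrightarrow> coeff h (degree p - 1) = lead_coeff p * f x"
proof -
  have "\<exists>h. (\<forall>l. poly h l = f (krylov M (synthetic_div p l) x)) \<and> (\<forall>k\<ge>degree p. coeff h k = 0) \<and>
     (degree p > 0 \<longrightarrow> coeff h (degree p - 1) = lead_coeff p * f x)"
    using assms
  proof (induction p arbitrary: f)
    case 0
    have "f 0 = 0"
      using 0(2)[of 0 0] by simp
    then show ?case
      by (auto intro!: exI[of _ 0])
  next
    case (pCons a p)
    have "\<exists>h. (\<forall>l. poly h l = f (M *v krylov M (synthetic_div p l) x)) \<and> (\<forall>k\<ge>degree p. coeff h k = 0) \<and>
     (degree p > 0 \<longrightarrow> coeff h (degree p - 1) = lead_coeff p * f (M *v x))"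
      using pCons.IH[of "\<lambda>y. f (M *v y)"] pCons.prems by (simp add: vec.add vec.scale)
    then obtain h where h: "\<And>l. poly h l = f (M *v krylov M (synthetic_div p l) x)"
      "\<And>k. k \<ge> degree p \<Longrightarrow> coeff h k = 0"
      by blast
    \<comment> \<open>Only \<open>smult (f x) p\<close> reaches the new top position
      \<open>degree p\<close>, which yields the leading coefficient.\<close>
    show ?case
      by (rule exI[of _ "smult (f x) p + h"])
         (use pCons.prems in \<open>auto simp: h coeff_eq_0\<close>)
  qed
  then show ?thesis
    using that by metis
qed

text \<open>Dividing by the gcd leaves a factor \<open>e\<close> of \<open>a\<close> coprime to the
  corresponding factor of \<open>h\<close>. At a root of \<open>e\<close> the local hypothesis would
  make \<open>e\<close> divide a polynomial not vanishing there; so \<open>e\<close> has no root and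
  is constant.\<close>

lemma dvd_if_locally_dvd:
  fixes a h :: "complex poly"
  assumes "a \<noteq> 0"
    and loc: "\<And>\<mu>. poly a \<mu> = 0 \<Longrightarrow> \<exists>d. poly d \<mu> \<noteq> 0 \<and> a dvd d * h"
  shows "a dvd h"
proof -
  let ?g = "gcd a h"
  obtain e where e: "a = ?g * e"
    by (meson dvdE gcd_dvd1)
  obtain h' where h': "h = ?g * h'"
    by (meson dvdE gcd_dvd2)
  have g0: "?g \<noteq> 0"
    using assms(1) by simp
  have cop: "coprime e h'"
    using gcd_coprime[OF g0, of e h'] e h' by (simp add: mult.commute)
  have "\<not> (\<exists>\<mu>. poly e \<mu> = 0)"
  proof
    assume "\<exists>\<mu>. poly e \<mu> = 0"
    then obtain \<mu> where \<mu>: "poly e \<mu> = 0" ..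
    then have "poly a \<mu> = 0"
      using arg_cong[OF e, of "\<lambda>p. poly p \<mu>"] by simp
    then obtain d where d: "poly d \<mu> \<noteq> 0" "a dvd d * h"
      using loc by blast
    then have "?g * e dvd ?g * (d * h')"
      using e h' by (metis mult.left_commute)
    then have "e dvd d * h'"
      using g0 dvd_mult_cancel_left by blast
    then have "e dvd d"
      using cop by (simp add: coprime_dvd_mult_left_iff)
    then show False
      using \<mu> d(1) by (auto elim!: dvdE)
  qed
  then have "degree e = 0"
    using fundamental_theorem_of_algebra constant_degree by blast
  moreover have "e \<noteq> 0"
    using e assms(1) by auto
  ultimately have "is_unit e"
    using is_unit_iff_degree by blast
  then have "a dvd ?g"
    using e by (metis dvd_mult_unit_iff dvd_refl)
  then show ?thesis
    by simp
qed

text \<open>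
  With \<open>a\<close> the minimal polynomial of \<open>M\<close> at \<open>x\<close>, the vector \<open>(a(M) - a(l)) / (M - l) x\<close> solves
  \<open>(M - l) y = - a(l) x\<close>. The local hypothesis forces every root of \<open>a\<close>, with multiplicity, on the
  polynomial \<open>f y\<close>, whose degree is smaller than that of \<open>a\<close>.
\<close>

lemma functional_vanishes_on_invariant_subspace:
  fixes M :: "complex^'n^'n" and f :: "complex^'n \<Rightarrow> complex"
  assumes f: "\<And>x y. f (x + y) = f x + f y" "\<And>c x. f (c *s x) = c * f x"
    and W: "vec.subspace W" "\<And>y. y \<in> W \<Longrightarrow> M *v y \<in> W"
    and \<Lambda>: "infinite \<Lambda>"
    and loc: "\<And>\<mu> z x. z \<in> W \<Longrightarrow> z \<noteq> 0 \<Longrightarrow> M *v z = \<mu> *s z \<Longrightarrow> x \<in> W \<Longrightarrow>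
      \<exists>d s. poly d \<mu> \<noteq> 0 \<and> poly s \<mu> = 0 \<and>
        (\<forall>l\<in>\<Lambda>. \<forall>y\<in>W. \<forall>c. M *v y - l *s y = c *s x \<longrightarrow> (l - \<mu>) * poly d l * f y = c * poly s l)"
    and x: "x \<in> W"
  shows "f x = 0"
proof -
  let ?P = "\<lambda>a. a \<noteq> 0 \<and> krylov M a x = 0"
  obtain a where a: "a \<noteq> 0" "krylov M a x = 0" and min: "\<And>b. ?P b \<Longrightarrow> degree a \<le> degree b"
  proof -
    obtain a0 where "?P a0"
      using annihilating_polynomial_exists by blast
    then show ?thesis
      using that ex_has_least_nat[of ?P a0 degree] by blast
  qed
  obtain h where h: "\<And>l. poly h l = f (krylov M (synthetic_div a l) x)"
    "\<And>k. degree a \<le> k \<Longrightarrow> coeff h k = 0"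
    "degree a > 0 \<Longrightarrow> coeff h (degree a - 1) = lead_coeff a * f x"
    using functional_of_resolvent_polynomial[of f M a x] f by metis
  have resolvent: "M *v krylov M (synthetic_div a l) x - l *s krylov M (synthetic_div a l) x
      = (- poly a l) *s x" for l
  proof -
    have "[:-l, 1:] * synthetic_div a l = a - [:poly a l:]"
      using synthetic_div_correct'[of l a] by (metis add_diff_cancel_right')
    then show ?thesis
      unfolding krylov_linear_factor[symmetric] by (simp add: krylov_diff a(2))
  qed
  have "\<exists>d. poly d \<mu> \<noteq> 0 \<and> a dvd d * h" if \<mu>: "poly a \<mu> = 0" for \<mu>
  proof -
    \<comment> \<open>The cofactor \<open>q\<close> has smaller degree than the minimal polynomial,
      so \<open>krylov M q x\<close> is nonzero, and it is an eigenvector for \<mu>. This makes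
      \<open>loc\<close> applicable at every root of \<open>a\<close>.\<close>
    obtain q where q: "a = [:-\<mu>, 1:] * q"
      using \<mu> by (metis dvdE poly_eq_0_iff_dvd)
    have "q \<noteq> 0"
      using q a(1) by auto
    then have "degree a = Suc (degree q)"
      unfolding q by (subst degree_mult_eq) auto
    then have "krylov M q x \<noteq> 0"
      using min[of q] \<open>q \<noteq> 0\<close> by auto
    moreover have "M *v krylov M q x = \<mu> *s krylov M q x"
      using a(2) krylov_linear_factor[of M \<mu> q x] q by simp
    ultimately obtain d s where ds: "poly d \<mu> \<noteq> 0" "poly s \<mu> = 0"
      "\<And>l y c. l \<in> \<Lambda> \<Longrightarrow> y \<in> W \<Longrightarrow> M *v y - l *s y = c *s x \<Longrightarrow>
         (l - \<mu>) * poly d l * f y = c * poly s l"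
      using loc[of "krylov M q x" \<mu> x] krylov_in_subspace[OF W x] x by metis
    obtain s' where s': "s = [:-\<mu>, 1:] * s'"
      using ds(2) by (metis dvdE poly_eq_0_iff_dvd)
    \<comment> \<open>At the resolvent solution, where c = - a(l), \<open>loc\<close> gives the
      identity at every \<open>l\<close> in \<Lambda>. As \<open>s\<close> shares the linear factor,
      cancelling it leaves \<open>a\<close> as a divisor of \<open>d * h\<close>.\<close>
    have "[:-\<mu>, 1:] * (d * h) = [:-\<mu>, 1:] * (- a * s')"
    proof (rule poly_eq_if_agree_infinitely[OF \<Lambda>])
      fix l assume "l \<in> \<Lambda>"
      then have "(l - \<mu>) * poly d l * poly h l = - poly a l * poly s l"
        using ds(3)[OF _ krylov_in_subspace[OF W x] resolvent] h(1) by simp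
      then show "poly ([:-\<mu>, 1:] * (d * h)) l = poly ([:-\<mu>, 1:] * (- a * s')) l"
        unfolding s' poly_mult by (simp add: algebra_simps)
    qed
    then have "d * h = - a * s'"
      by (subst (asm) mult_cancel_left) auto
    then have "a dvd d * h"
      by simp
    with ds(1) show ?thesis
      by blast
  qed
  then have "a dvd h"
    by (rule dvd_if_locally_dvd[OF a(1)])
  have "h = 0"
  proof (rule ccontr)
    assume "h \<noteq> 0"
    then have "coeff h (degree h) \<noteq> 0" by simp
    then have "degree h < degree a"
      using h(2) not_le by blast
    then show False
      using \<open>a dvd h\<close> \<open>h \<noteq> 0\<close> dvd_imp_degree_le not_le by blast
  qed
  show ?thesis
  \<comment> \<open>The coefficient at \<open>degree a - 1\<close> is available only in positive
    degree. In degree zero a nonzero constant annihilates \<open>x\<close>, so \<open>x\<close>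
    itself is zero.\<close>
  proof (cases "degree a = 0")
    case True
    then obtain c where "a = [:c:]"
      using degree_eq_zeroE by blast
    then have "c \<noteq> 0" "c *s x = 0"
      using a by simp_all
    then have "x = 0" by simp
    then show ?thesis
      using f(2)[of 0 0] by simp
  next
    case False
    then show ?thesis
      using h(3) a(1) \<open>h = 0\<close> by simp
  qed
qed

subsection \<open>The system pencil\<close>

definition join_vec :: "'a^'n \<Rightarrow> 'a^'m \<Rightarrow> 'a^('n + 'm)" where
  "join_vec x u = (\<chi> k. case k of Inl a \<Rightarrow> x $ a | Inr b \<Rightarrow> u $ b)"

lemma join_vec_nth [simp]: "join_vec x u $ Inl a = x $ a" "join_vec x u $ Inr b = u $ b"
  by (simp_all add: join_vec_def)

lemma vec_sum_eq_iff: "z = w \<longleftrightarrow> (\<forall>a. z $ Inl a = w $ Inl a) \<and> (\<forall>b. z $ Inr b = w $ Inr b)"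
  by (auto simp: vec_eq_iff) (metis sum.exhaust)

lemma join_vec_cases:
  obtains x u where "z = join_vec x u"
proof
  show "z = join_vec (\<chi> a. z $ Inl a) (\<chi> b. z $ Inr b)"
    by (simp add: vec_sum_eq_iff)
qed

lemma sum_UNIV_Plus:
  fixes f :: "'a::finite + 'b::finite \<Rightarrow> 'c::comm_monoid_add"
  shows "(\<Sum>k\<in>UNIV. f k) = (\<Sum>a\<in>UNIV. f (Inl a)) + (\<Sum>b\<in>UNIV. f (Inr b))"
  unfolding UNIV_Plus_UNIV[symmetric] by (subst sum.Plus) auto

lemma block_matrix_mult:
  "block_matrix P Q R S *v join_vec x u = join_vec (P *v x + Q *v u) (R *v x + S *v u)"
  for P :: "'a::semiring_1^'n^'r"
  by (simp add: vec_sum_eq_iff matrix_vector_mult_def block_matrix_def sum_UNIV_Plus)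

section \<open>Complexification of real vectors and matrices\<close>

abbreviation cmat :: "real^'c^'r \<Rightarrow> complex^'c^'r" where
  "cmat \<equiv> map_matrix complex_of_real"

definition cvec :: "real^'n \<Rightarrow> complex^'n" where
  "cvec x = (\<chi> i. complex_of_real (x $ i))"

definition Re_vec :: "complex^'n \<Rightarrow> real^'n" where
  "Re_vec z = (\<chi> i. Re (z $ i))"

definition Im_vec :: "complex^'n \<Rightarrow> real^'n" where
  "Im_vec z = (\<chi> i. Im (z $ i))"

lemmas complex_vec_defs = cvec_def Re_vec_def Im_vec_def

lemma Re_vec_simps [simp]:
  "Re_vec (z + w) = Re_vec z + Re_vec w" "Im_vec (z + w) = Im_vec z + Im_vec w"
  "Re_vec (z - w) = Re_vec z - Re_vec w" "Im_vec (z - w) = Im_vec z - Im_vec w"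
  "Re_vec (cvec x) = x" "Im_vec (cvec x) = 0" "Re_vec 0 = 0" "Im_vec 0 = 0"
  "Re_vec (c *s z) = Re c *\<^sub>R Re_vec z - Im c *\<^sub>R Im_vec z"
  "Im_vec (c *s z) = Re c *\<^sub>R Im_vec z + Im c *\<^sub>R Re_vec z"
  by (simp_all add: complex_vec_defs vec_eq_iff)

lemma Re_vec_cmat_mult [simp]:
  "Re_vec (cmat M *v z) = M *v Re_vec z" "Im_vec (cmat M *v z) = M *v Im_vec z"
  by (simp_all add: complex_vec_defs vec_eq_iff matrix_vector_mult_def map_matrix_def)

lemma complex_vec_eq_iff: "z = w \<longleftrightarrow> Re_vec z = Re_vec w \<and> Im_vec z = Im_vec w"
  by (auto simp: complex_vec_defs vec_eq_iff complex_eq_iff)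

lemma cmat_mult: "cmat (M ** N) = cmat M ** cmat N"
  by (simp add: map_matrix_def matrix_matrix_mult_def vec_eq_iff)

lemma cmat_add: "cmat (M + N) = cmat M + cmat N"
  by (simp add: map_matrix_def vec_eq_iff)

lemma mat_mult_vec: "mat c *v x = c *s x" for c :: "'a::comm_semiring_1"
  by (simp add: mat_def matrix_vector_mult_def vec_eq_iff if_distrib[of "\<lambda>x. x * _"] cong: if_cong)

lemma pencil_join_vec:
  "pencil A B C D l *v join_vec x u =
     join_vec (cmat A *v x - l *s x + cmat B *v u) (cmat C *v x + cmat D *v u)"
  by (simp add: pencil_def block_matrix_mult matrix_vector_mult_diff_rdistrib mat_mult_vec)

lemma eval_pencil_poly: "eval_mat (pencil_poly A B C D) l = pencil A B C D l"
  by (auto simp: eval_mat_def pencil_poly_def pencil_def block_matrix_def vec_eq_iff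
      map_matrix_def mat_def split: sum.split)

lemma normal_rank_right_invertible:
  fixes A :: "real^'n^'n" and B :: "real^'m^'n" and C :: "real^'n^'p" and D :: "real^'m^'p"
  assumes "right_invertible A B C D"
  shows "normal_rank A B C D = CARD('n + 'p)" and "\<exists>l. rank (pencil A B C D l) = CARD('n + 'p)"
proof -
  have "infinite (UNIV :: complex set)"
    by (rule infinite_UNIV_char_0)
  then obtain l where l: "rank (pencil A B C D l) = CARD('n + 'p)"
    using assms unfolding right_invertible_def
    by (metis (mono_tags, lifting) UNIV_I card_sum mem_Collect_eq rev_finite_subset subsetI)
  then show "\<exists>l. rank (pencil A B C D l) = CARD('n + 'p)" ..
  have "rank (pencil A B C D k) \<le> CARD('n + 'p)" for k
    by (rule rank_le_rows)
  then have "finite (range (\<lambda>l. rank (pencil A B C D l)))"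
    using finite_nat_set_iff_bounded_le by auto
  then show "normal_rank A B C D = CARD('n + 'p)"
    unfolding normal_rank_def using l rank_le_rows[of "pencil A B C D _"]
    by (intro Max_eqI) (auto, metis rangeI)
qed

text \<open>If the power exceeding the rank deficiency divided every maximal minor, it would divide
  their gcd, whose order at \<mu> is the algebraic multiplicity and hence equals the deficiency. At
  full rank, a minor that is nonzero at \<mu> does it.\<close>

lemma maximal_minor_of_minimal_order:
  fixes A :: "real^'n^'n" and B :: "real^'m^'n" and C :: "real^'n^'p" and D :: "real^'m^'p"
  assumes ri: "right_invertible A B C D"
    and mult: "rank (pencil A B C D \<mu>) < CARD('n + 'p) \<Longrightarrow>
      algebraic_multiplicity A B C D \<mu> = geometric_multiplicity A B C D \<mu>"
  obtains h where "inj h"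
    "\<not> [:-\<mu>, 1:] ^ Suc (CARD('n + 'p) - rank (pencil A B C D \<mu>)) dvd
       det (select_columns (pencil_poly A B C D) h)"
proof (cases "rank (pencil A B C D \<mu>) = CARD('n + 'p)")
  case True
  then obtain h where h: "inj h" "det (select_columns (pencil A B C D \<mu>) h) \<noteq> 0"
    using full_row_rank_select_columns[of "pencil A B C D \<mu>"] surj_iff_full_row_rank by metis
  then have "poly (det (select_columns (pencil_poly A B C D) h)) \<mu> \<noteq> 0"
    by (simp add: poly_det eval_mat_select_columns eval_pencil_poly)
  then have "\<not> [:-\<mu>, 1:] dvd det (select_columns (pencil_poly A B C D) h)"
    by (simp add: poly_eq_0_iff_dvd)
  then show ?thesis
    using that[OF h(1)] True by simp
next
  case False
  let ?N = "CARD('n + 'p)"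
  let ?M = "pencil_poly A B C D"
  let ?k = "Suc (?N - rank (pencil A B C D \<mu>))"
  let ?Z = "zero_polynomial A B C D"
  have nr: "normal_rank A B C D = ?N"
    by (rule normal_rank_right_invertible(1)[OF ri])
  have Z: "?Z = Gcd {minor ?M ?N f g |f g. inj_on f {..<?N} \<and> inj_on g {..<?N}}"
    by (simp add: zero_polynomial_def nr Let_def)
  have lt: "rank (pencil A B C D \<mu>) < ?N"
    using False rank_le_rows[of "pencil A B C D \<mu>"] by simp
  obtain l0 where "rank (pencil A B C D l0) = ?N"
    using normal_rank_right_invertible(2)[OF ri] by blast
  then obtain h0 where h0: "inj h0" "det (select_columns (pencil A B C D l0) h0) \<noteq> 0"
    using full_row_rank_select_columns[of "pencil A B C D l0"] surj_iff_full_row_rank by metis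
  then have "poly (det (select_columns ?M h0)) l0 \<noteq> 0"
    by (simp add: poly_det eval_mat_select_columns eval_pencil_poly)
  then have det0: "det (select_columns ?M h0) \<noteq> 0"
    by auto
  \<comment> \<open>The order limits divisibility only for a nonzero polynomial. The minor that is
    nonzero at \<open>l0\<close> shows that the gcd is nonzero.\<close>
  have "?Z \<noteq> 0"
  proof
    assume Z0: "?Z = 0"
    obtain f where f: "bij_betw f {..<?N} (UNIV :: ('n + 'p) set)"
      using finite_same_card_bij[of "{..<?N}" "UNIV :: ('n + 'p) set"] by auto
    then have inj: "inj_on f {..<?N}"
      by (rule bij_betw_imp_inj_on)
    have "h0 \<circ> f \<circ> inv_into {..<?N} f = h0"
      using f by (auto simp: fun_eq_iff bij_betw_def f_inv_into_f)
    then have "minor ?M ?N f (h0 \<circ> f) = det (select_columns ?M h0)"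
      using minor_eq_det[OF inj, of ?M "h0 \<circ> f"] by simp
    moreover have "inj_on (h0 \<circ> f) {..<?N}"
      using inj h0(1) by (simp add: comp_inj_on inj_on_subset)
    ultimately have "det (select_columns ?M h0) \<in> {minor ?M ?N f g |f g. inj_on f {..<?N} \<and> inj_on g {..<?N}}"
      using inj by (metis (mono_tags, lifting) mem_Collect_eq)
    then have "?Z dvd det (select_columns ?M h0)"
      unfolding Z by (rule Gcd_dvd)
    then show False
      using Z0 det0 by simp
  qed
  moreover have "order \<mu> ?Z = ?N - rank (pencil A B C D \<mu>)"
    using mult[OF lt] by (simp add: algebraic_multiplicity_def geometric_multiplicity_def nr)
  ultimately have "\<not> [:-\<mu>, 1:] ^ ?k dvd ?Z"
    by (simp add: order_divides del: power_Suc)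
  then obtain f g where fg: "inj_on f {..<?N}" "inj_on g {..<?N}" "\<not> [:-\<mu>, 1:] ^ ?k dvd minor ?M ?N f g"
    unfolding Z using Gcd_greatest[of "{minor ?M ?N f g |f g. inj_on f {..<?N} \<and> inj_on g {..<?N}}"] by blast
  have "bij_betw f {..<?N} UNIV"
    using fg(1) card_image[OF fg(1)] by (simp add: bij_betw_def card_eq_UNIV_imp_eq_UNIV)
  then have "bij_betw (inv_into {..<?N} f) UNIV {..<?N}"
    by (rule bij_betw_inv_into)
  then have "inj (g \<circ> inv_into {..<?N} f)"
    using fg(2) by (auto simp: bij_betw_def intro: comp_inj_on)
  then show ?thesis
    using that fg(3) unfolding minor_eq_det[OF fg(1)] by blast
qed

lemma pencil_local_right_inverse:
  fixes A :: "real^'n^'n" and B :: "real^'m^'n" and C :: "real^'n^'p" and D :: "real^'m^'p"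
  assumes ri: "right_invertible A B C D"
    and mult: "rank (pencil A B C D \<mu>) < CARD('n + 'p) \<Longrightarrow>
      algebraic_multiplicity A B C D \<mu> = geometric_multiplicity A B C D \<mu>"
  obtains d :: "complex poly" and q :: "complex poly^('n + 'm)"
  where "poly d \<mu> \<noteq> 0"
    "\<And>l. pencil A B C D l *v (\<chi> c. poly (q $ c) l) = ((l - \<mu>) * poly d l) *s b"
    "\<And>c. rank (pencil A B C D \<mu>) = CARD('n + 'p) \<Longrightarrow> poly (q $ c) \<mu> = 0"
proof -
  obtain h where "inj h"
    "\<not> [:-\<mu>, 1:] ^ Suc (CARD('n + 'p) - rank (eval_mat (pencil_poly A B C D) \<mu>)) dvd
       det (select_columns (pencil_poly A B C D) h)"
    using maximal_minor_of_minimal_order[OF ri mult] unfolding eval_pencil_poly by metis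
  from local_right_inverse[OF this, of b] show ?thesis
    using that unfolding eval_pencil_poly by metis
qed

section \<open>Null directions and output-nulling subspaces\<close>

lemma infinite_real_stability_region: "infinite (real_stability_region td)"
proof -
  have "{-1<..<0} \<subseteq> real_stability_region td"
    by (cases td) (auto simp: real_stability_region_def)
  then show ?thesis
    using infinite_Ioo[of "-1" "0::real"] finite_subset by (metis neg_less_0_iff_less zero_less_one)
qed

text \<open>The counterpart of \<open>L_generators\<close> with zero output: the nonzero members are
  the vectors that some feedback turns into eigenvectors with a real stable eigenvalue, invisible at
  the output.\<close>

definition null_generators ::
  "time_domain \<Rightarrow> real^'n^'n \<Rightarrow> real^'m^'n \<Rightarrow> real^'n^'p \<Rightarrow> real^'m^'p \<Rightarrow> (real^'n) set" where
  "null_generators td A B C D =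
     {v. \<exists>l \<in> real_stability_region td. \<exists>w :: real^'m.
        (A - mat l) *v v + B *v w = 0 \<and> C *v v + D *v w = 0}"

lemma mat_diff_mult_vec: "(A - mat l) *v v = A *v v - l *\<^sub>R v" for l :: real
  by (simp add: matrix_vector_mult_diff_rdistrib mat_mult_vec scalar_mult_eq_scaleR)

text \<open>At a real frequency the pencil is a real matrix, so its complex kernel vectors split
  into real and imaginary parts. This is what the reality of the minimum-phase zeros is used
  for.\<close>

lemma pencil_kernel_in_null_generators:
  assumes "l \<in> real_stability_region td" "pencil A B C D (of_real l) *v join_vec x u = 0"
  shows "Re_vec x \<in> null_generators td A B C D" "Im_vec x \<in> null_generators td A B C D"
proof -
  have "cmat A *v x - of_real l *s x + cmat B *v u = 0" "cmat C *v x + cmat D *v u = 0"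
    using assms(2) by (simp_all add: pencil_join_vec vec_sum_eq_iff vec_eq_iff)
  then have "A *v Re_vec x - l *\<^sub>R Re_vec x + B *v Re_vec u = 0 \<and> C *v Re_vec x + D *v Re_vec u = 0"
    "A *v Im_vec x - l *\<^sub>R Im_vec x + B *v Im_vec u = 0 \<and> C *v Im_vec x + D *v Im_vec u = 0"
    by (simp_all add: complex_vec_eq_iff)
  then show "Re_vec x \<in> null_generators td A B C D" "Im_vec x \<in> null_generators td A B C D"
    using assms(1) by (auto simp: null_generators_def mat_diff_mult_vec)
qed

text \<open>On the complexification \<open>W\<close> of \<open>V\<close> the pencil sends (z, F z)
  to ((M - l) z, 0) with M = A + B F. A resolvent equation in \<open>W\<close> thus becomes a pencil
  equation, comparable with the local right inverse.\<close>

lemma stabilizability_output_nulling_le_span: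
  fixes A :: "real^'n^'n" and B :: "real^'m^'n" and C :: "real^'n^'p" and D :: "real^'m^'p"
  assumes ri: "right_invertible A B C D"
    and mult: "\<And>z. z \<in> minimum_phase_zeros td A B C D \<Longrightarrow>
      algebraic_multiplicity A B C D z = geometric_multiplicity A B C D z"
    and real: "minimum_phase_zeros td A B C D \<subseteq> \<real>"
    and V: "stabilizability_output_nulling td A B C D V"
  shows "V \<subseteq> span (null_generators td A B C D)"
proof
  fix x0 assume x0: "x0 \<in> V"
  obtain F where F: "\<And>x. x \<in> V \<Longrightarrow> (A + B ** F) *v x \<in> V" "\<And>x. x \<in> V \<Longrightarrow> (C + D ** F) *v x = 0"
    "spectrum_on (A + B ** F) V \<subseteq> stability_region td" and subV: "subspace V"
    using V unfolding stabilizability_output_nulling_def by blast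
  define W where "W = {z. Re_vec z \<in> V \<and> Im_vec z \<in> V}"
  let ?M = "cmat (A + B ** F)"
  have subW: "vec.subspace W"
    using subV by (intro vec.subspaceI)
      (auto simp: W_def subspace_0 subspace_add subspace_scale subspace_diff)
  have MW: "?M *v z \<in> W" if "z \<in> W" for z
    using that F(1) by (auto simp: W_def simp del: matrix_vector_mult_add_rdistrib)
  have eig: "\<mu> \<in> stability_region td" if "z \<in> W" "z \<noteq> 0" "?M *v z = \<mu> *s z" for z \<mu>
    using that F(3) by (auto simp: spectrum_on_def W_def Re_vec_def Im_vec_def)
  have pen: "pencil A B C D l *v join_vec z (cmat F *v z) = join_vec (?M *v z - l *s z) 0"
    if "z \<in> W" for z l
  proof -
    have "cmat (C + D ** F) *v z = 0"
      using that F(2) by (simp add: complex_vec_eq_iff W_def del: matrix_vector_mult_add_rdistrib)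
    then show ?thesis
      by (simp add: pencil_join_vec cmat_add cmat_mult matrix_vector_mult_add_rdistrib
          matrix_vector_mul_assoc algebra_simps)
  qed
  \<comment> \<open>A subspace equals its double orthogonal complement, so membership is tested by
    the functionals vanishing on the null directions.\<close>
  have "orthogonal \<phi> x0" if orth: "\<And>y. y \<in> span (null_generators td A B C D) \<Longrightarrow> orthogonal \<phi> y" for \<phi>
  proof -
    define f :: "complex^'n \<Rightarrow> complex" where "f z = (\<Sum>i\<in>UNIV. of_real (\<phi> $ i) * z $ i)" for z
    have f_add: "f (z + w) = f z + f w" for z w
      by (simp add: f_def algebra_simps sum.distrib)
    have f_scale: "f (c *s z) = c * f z" for c z
      by (simp add: f_def sum_distrib_left mult.left_commute)
    have f_diff: "f (z - w) = f z - f w" for z w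
      using f_add[of "z - w" w] by simp
    have f_eq: "f z = Complex (\<phi> \<bullet> Re_vec z) (\<phi> \<bullet> Im_vec z)" for z
      by (simp add: f_def complex_eq_iff inner_vec_def Re_vec_def Im_vec_def)
    \<comment> \<open>This is available at real stable frequencies only; there are infinitely many,
      which suffices to compare polynomials.\<close>
    have kill: "f x = 0" if "l \<in> real_stability_region td" "pencil A B C D (of_real l) *v join_vec x u = 0" for l x u
      using pencil_kernel_in_null_generators[OF that] orth span_base
      by (auto simp: f_eq orthogonal_def complex_eq_iff)
    have "f (cvec x0) = 0"
    proof (rule functional_vanishes_on_invariant_subspace[OF f_add f_scale subW MW])
      show "infinite (complex_of_real ` real_stability_region td)"
        using infinite_real_stability_region by (simp add: finite_image_iff inj_on_def)
      show "cvec x0 \<in> W"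
        using x0 subV by (simp add: W_def subspace_0)
    next
      fix \<mu> z x assume "z \<in> W" "z \<noteq> 0" "?M *v z = \<mu> *s z"
      then have \<mu>: "\<mu> \<in> stability_region td"
        by (rule eig)
      let ?full = "rank (pencil A B C D \<mu>) = CARD('n + 'p)"
      have zero: "\<mu> \<in> minimum_phase_zeros td A B C D" if "\<not> ?full"
        using that \<mu> rank_le_rows[of "pencil A B C D \<mu>"] normal_rank_right_invertible(1)[OF ri]
        by (simp add: minimum_phase_zeros_def invariant_zeros_def)
      then have m: "rank (pencil A B C D \<mu>) < CARD('n + 'p) \<Longrightarrow>
          algebraic_multiplicity A B C D \<mu> = geometric_multiplicity A B C D \<mu>"
        using mult by simp
      obtain d :: "complex poly" and q :: "complex poly^('n + 'm)" where dq: "poly d \<mu> \<noteq> 0"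
        "\<And>l. pencil A B C D l *v (\<chi> c. poly (q $ c) l) = ((l - \<mu>) * poly d l) *s join_vec x 0"
        "\<And>c. ?full \<Longrightarrow> poly (q $ c) \<mu> = 0"
        using pencil_local_right_inverse[OF ri m, of "join_vec x 0"] by metis
      define qx where "qx l = (\<chi> a. poly (q $ Inl a) l)" for l
      define qu where "qu l = (\<chi> a. poly (q $ Inr a) l)" for l
      have q: "(\<chi> c. poly (q $ c) l) = join_vec (qx l) (qu l)" for l
        by (simp add: vec_sum_eq_iff qx_def qu_def)
      define s where "s = (\<Sum>a\<in>UNIV. [:of_real (\<phi> $ a):] * q $ Inl a)"
      have s: "poly s l = f (qx l)" for l
        by (simp add: s_def poly_sum f_def qx_def)
      have "poly s \<mu> = 0"
      proof (cases ?full)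
        case True
        then show ?thesis
          using dq(3) by (simp add: s_def poly_sum)
      next
        case False
        then obtain r where r: "\<mu> = of_real r"
          using zero real by (auto elim!: Reals_cases)
        then have "r \<in> real_stability_region td"
          using \<mu> by (simp add: real_stability_region_def)
        then show ?thesis
          using kill[of r "qx \<mu>" "qu \<mu>"] dq(2)[of \<mu>] unfolding s q r by simp
      qed
      moreover have "(l - \<mu>) * poly d l * f y = c * poly s l"
        if l: "l \<in> complex_of_real ` real_stability_region td" and y: "y \<in> W"
          and eq: "?M *v y - l *s y = c *s x" for l y c
      proof -
        let ?k = "(l - \<mu>) * poly d l"
        \<comment> \<open>The two vectors, scaled by \<open>?k\<close> and \<open>c\<close>, have
          the same image under the pencil; their difference lies in the kernel and is killed by
          \<open>f\<close>.\<close>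
        have "pencil A B C D l *v (?k *s join_vec y (cmat F *v y) - c *s join_vec (qx l) (qu l))
            = ?k *s join_vec (c *s x) 0 - c *s (?k *s join_vec x 0)"
          using dq(2)[of l] unfolding q by (simp add: vec.diff vec.scale pen[OF y] eq)
        also have "\<dots> = 0"
          by (simp add: vec_sum_eq_iff)
        also have "?k *s join_vec y (cmat F *v y) - c *s join_vec (qx l) (qu l)
            = join_vec (?k *s y - c *s qx l) (?k *s (cmat F *v y) - c *s qu l)"
          by (simp add: vec_sum_eq_iff)
        finally have "f (?k *s y - c *s qx l) = 0"
          using l kill by blast
        then show ?thesis
          by (simp add: f_diff f_scale s)
      qed
      ultimately show "\<exists>d s. poly d \<mu> \<noteq> 0 \<and> poly s \<mu> = 0 \<and>
        (\<forall>l\<in>complex_of_real ` real_stability_region td. \<forall>y\<in>W. \<forall>c.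
          ?M *v y - l *s y = c *s x \<longrightarrow> (l - \<mu>) * poly d l * f y = c * poly s l)"
        using dq(1) by blast
    qed
    then show ?thesis
      by (simp add: f_eq orthogonal_def complex_eq_iff)
  qed
  then have "x0 \<in> (span (null_generators td A B C D))\<^sup>\<bottom>\<^sup>\<bottom>"
    by (auto simp: orthogonal_comp_def orthogonal_commute)
  then show "x0 \<in> span (null_generators td A B C D)"
    by (simp add: orthogonal_comp_self)
qed

subsection \<open>Rado's theorem for vector spaces\<close>

text \<open>
  If some set has two elements, then one of them can be discarded: by submodularity of the dimension,
  violations of the rank condition for both smaller families would add up to one for the given family.
\<close>

lemma rado_finite_sets:
  fixes S :: "'i \<Rightarrow> 'a::euclidean_space set"
  assumes "finite I" "\<And>i. i \<in> I \<Longrightarrow> finite (S i)"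
    and "\<And>J. J \<subseteq> I \<Longrightarrow> card J \<le> dim (\<Union>i\<in>J. S i)"
  shows "\<exists>f. (\<forall>i\<in>I. f i \<in> S i) \<and> inj_on f I \<and> independent (f ` I)"
  using assms(2,3)
proof (induction "\<Sum>i\<in>I. card (S i)" arbitrary: S rule: less_induct)
  case less
  note fin = less.prems(1) and rank = less.prems(2)
  show ?case
  proof (cases "\<exists>i\<in>I. \<exists>x\<in>S i. \<exists>y\<in>S i. x \<noteq> y")
    case False
    \<comment> \<open>All sets are singletons here, and the rank condition for \<open>I\<close>
      itself says that their elements are distinct and independent.\<close>
    have ne: "S i \<noteq> {}" if "i \<in> I" for i
      using rank[of "{i}"] that by auto
    define f where "f i = (SOME x. x \<in> S i)" for i
    have f: "S i = {f i}" if "i \<in> I" for i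
      using False ne[OF that] that someI_ex[of "\<lambda>x. x \<in> S i"] unfolding f_def by blast
    have "(\<Union>i\<in>I. S i) = f ` I"
      using f by auto
    then have d: "card I \<le> dim (f ` I)"
      using rank[of I] by simp
    have "dim (f ` I) \<le> card (f ` I)"
      using assms(1) by (simp add: dim_le_card')
    then have c: "card (f ` I) = card I"
      using d card_image_le[OF assms(1), of f] by simp
    then have "inj_on f I"
      using assms(1) by (rule eq_card_imp_inj_on[rotated])
    moreover have "independent (f ` I)"
      using card_le_dim_spanning[of "f ` I" "f ` I"] span_superset[of "f ` I"] assms(1) d c by simp
    ultimately show ?thesis
      using f by blast
  next
    case True
    then obtain i x y where i: "i \<in> I" and xy: "x \<in> S i" "y \<in> S i" "x \<noteq> y"
      by blast
    let ?S = "\<lambda>z. S(i := S i - {z})"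
    have smaller: "?thesis" if z: "z \<in> S i" and r: "\<And>J. J \<subseteq> I \<Longrightarrow> card J \<le> dim (\<Union>k\<in>J. ?S z k)" for z
    proof -
      have "card (S i - {z}) < card (S i)"
        using fin[OF i] z by (intro psubset_card_mono) auto
      then have "(\<Sum>k\<in>I. card (?S z k)) < (\<Sum>k\<in>I. card (S k))"
        using assms(1) i by (intro sum_strict_mono_ex1) auto
      moreover have "finite (?S z k)" if "k \<in> I" for k
        using fin that by auto
      ultimately obtain f where "\<forall>k\<in>I. f k \<in> ?S z k" "inj_on f I" "independent (f ` I)"
        using less.hyps[of "?S z"] r by blast
      moreover have "?S z k \<subseteq> S k" for k
        by auto
      ultimately show ?thesis
        by blast
    qed
    show ?thesis
    proof (rule ccontr)
      assume no: "\<not> ?thesis"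
      have "\<exists>J\<subseteq>I. dim (\<Union>k\<in>J. ?S z k) < card J" if "z \<in> S i" for z
        using smaller[OF that] no not_le by blast
      then obtain J K where J: "J \<subseteq> I" "dim (\<Union>k\<in>J. ?S x k) < card J"
        and K: "K \<subseteq> I" "dim (\<Union>k\<in>K. ?S y k) < card K"
        using xy by meson
      have iJ: "i \<in> J"
      proof (rule ccontr)
        assume "i \<notin> J"
        then have "(\<Union>k\<in>J. ?S x k) = (\<Union>k\<in>J. S k)" by auto
        then show False using J rank[of J] by simp
      qed
      have iK: "i \<in> K"
      proof (rule ccontr)
        assume "i \<notin> K"
        then have "(\<Union>k\<in>K. ?S y k) = (\<Union>k\<in>K. S k)" by auto
        then show False using K rank[of K] by simp
      qed
      have finJK: "finite J" "finite K"
        using J(1) K(1) assms(1) finite_subset by auto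
      let ?U = "span (\<Union>k\<in>J. ?S x k)" and ?V = "span (\<Union>k\<in>K. ?S y k)"
      have sumUV: "{a + b |a b. a \<in> ?U \<and> b \<in> ?V} = span ((\<Union>k\<in>J. ?S x k) \<union> (\<Union>k\<in>K. ?S y k))"
        by (auto simp: span_Un)
      \<comment> \<open>Nothing is lost in the union: \<open>i\<close> lies in both \<open>J\<close>
        and \<open>K\<close>, and distinct elements were removed from \<open>S i\<close>.\<close>
      have "(\<Union>k\<in>J \<union> K. S k) \<subseteq> (\<Union>k\<in>J. ?S x k) \<union> (\<Union>k\<in>K. ?S y k)"
      proof
        fix v assume "v \<in> (\<Union>k\<in>J \<union> K. S k)"
        then obtain k where k: "k \<in> J \<union> K" "v \<in> S k" by blast
        show "v \<in> (\<Union>k\<in>J. ?S x k) \<union> (\<Union>k\<in>K. ?S y k)"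
        proof (cases "k = i")
          case True
          then have "v \<in> ?S x i \<or> v \<in> ?S y i"
            using k(2) xy(3) by auto
          then show ?thesis using iJ iK by blast
        next
          case False
          then have "v \<in> ?S x k" "v \<in> ?S y k"
            using k(2) by auto
          then show ?thesis using k(1) by blast
        qed
      qed
      then have "dim (\<Union>k\<in>J \<union> K. S k) \<le> dim {a + b |a b. a \<in> ?U \<and> b \<in> ?V}"
        unfolding sumUV dim_span by (rule dim_subset)
      then have "card (J \<union> K) \<le> dim {a + b |a b. a \<in> ?U \<and> b \<in> ?V}"
        using rank[of "J \<union> K"] J(1) K(1) by simp
      moreover have "card (J \<inter> K - {i}) \<le> dim (?U \<inter> ?V)"
      proof -
        have "(\<Union>k\<in>J \<inter> K - {i}. S k) \<subseteq> (\<Union>k\<in>J. ?S x k) \<inter> (\<Union>k\<in>K. ?S y k)"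
          by fastforce
        then have "(\<Union>k\<in>J \<inter> K - {i}. S k) \<subseteq> ?U \<inter> ?V"
          using span_superset by blast
        then have "dim (\<Union>k\<in>J \<inter> K - {i}. S k) \<le> dim (?U \<inter> ?V)"
          by (rule dim_subset)
        then show ?thesis
          using rank[of "J \<inter> K - {i}"] J(1) by (meson Diff_subset inf.coboundedI1 le_trans subset_trans)
      qed
      moreover have "dim {a + b |a b. a \<in> ?U \<and> b \<in> ?V} + dim (?U \<inter> ?V) = dim ?U + dim ?V"
        by (rule dim_sums_Int) auto
      moreover have "card (J \<union> K) + card (J \<inter> K) = card J + card K"
        using card_Un_Int[OF finJK] by simp
      moreover have "card (J \<inter> K - {i}) = card (J \<inter> K) - 1"
        using iJ iK by simp
      moreover have "card (J \<inter> K) > 0"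
        using iJ iK finJK by (auto simp: card_gt_0_iff)
      \<comment> \<open>Each violation costs at least one, so the dimensions of \<open>?U\<close>
        and \<open>?V\<close> sum to at most card J + card K - 2; omitting \<open>i\<close> from the
        intersection costs one only.\<close>
      ultimately show False
        using J(2) K(2) by simp
    qed
  qed
qed

text \<open>Each set shrinks to a finite subset with the same span, which leaves the rank condition
  intact.\<close>

lemma rado:
  fixes S :: "'i \<Rightarrow> 'a::euclidean_space set"
  assumes "finite I" and "\<And>J. J \<subseteq> I \<Longrightarrow> card J \<le> dim (\<Union>i\<in>J. S i)"
  shows "\<exists>f. (\<forall>i\<in>I. f i \<in> S i) \<and> inj_on f I \<and> independent (f ` I)"
proof -
  have "\<exists>B. B \<subseteq> S i \<and> finite B \<and> S i \<subseteq> span B" for i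
    using basis_exists[of "S i"] finiteI_independent by metis
  then obtain B where B: "\<And>i. B i \<subseteq> S i" "\<And>i. finite (B i)" "\<And>i. S i \<subseteq> span (B i)"
    by metis
  have "card J \<le> dim (\<Union>i\<in>J. B i)" if "J \<subseteq> I" for J
  proof -
    have "(\<Union>i\<in>J. S i) \<subseteq> span (\<Union>i\<in>J. B i)"
      using B(3) span_mono[of "B _" "\<Union>i\<in>J. B i"] by blast
    then have "dim (\<Union>i\<in>J. S i) \<le> dim (\<Union>i\<in>J. B i)"
      by (metis dim_span dim_subset)
    then show ?thesis
      using assms(2)[OF that] by simp
  qed
  then obtain f where "\<forall>i\<in>I. f i \<in> B i" "inj_on f I" "independent (f ` I)"
    using rado_finite_sets[OF assms(1), of B] B(2) by blast
  then show ?thesis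
    using B(1) by blast
qed

text \<open>Rado's theorem is applied to \<open>\<mu> k\<close> copies of each \<open>S k\<close>.
  Completing a set of copies to all copies of the same indices enlarges its cardinality but not the
  union, so the condition on index sets suffices.\<close>

lemma rado_multiplicities:
  fixes S :: "'k::finite \<Rightarrow> 'a::euclidean_space set" and \<mu> :: "'k \<Rightarrow> nat"
  assumes "\<And>P. (\<Sum>k\<in>P. \<mu> k) \<le> dim (\<Union>k\<in>P. S k)"
  obtains v where "\<And>k j. j < \<mu> k \<Longrightarrow> v k j \<in> S k"
    "inj_on (\<lambda>(k, j). v k j) (SIGMA k:UNIV. {..<\<mu> k})"
    "independent ((\<lambda>(k, j). v k j) ` (SIGMA k:UNIV. {..<\<mu> k}))"
proof -
  let ?I = "SIGMA k:UNIV. {..<\<mu> k}"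
  have "card J \<le> dim (\<Union>i\<in>J. S (fst i))" if "J \<subseteq> ?I" for J
  proof -
    have "J \<subseteq> (SIGMA k:fst ` J. {..<\<mu> k})"
      using that by force
    then have "card J \<le> card (SIGMA k:fst ` J. {..<\<mu> k})"
      by (intro card_mono) auto
    also have "\<dots> = (\<Sum>k\<in>fst ` J. \<mu> k)"
      by (simp add: card_SigmaI)
    also have "\<dots> \<le> dim (\<Union>k\<in>fst ` J. S k)"
      by (rule assms)
    also have "(\<Union>k\<in>fst ` J. S k) = (\<Union>i\<in>J. S (fst i))"
      by simp
    finally show ?thesis .
  qed
  then obtain f where f: "\<forall>i\<in>?I. f i \<in> S (fst i)" "inj_on f ?I" "independent (f ` ?I)"
    using rado[of ?I "\<lambda>i. S (fst i)"] by auto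
  have "f = (\<lambda>(k, j). curry f k j)"
    by simp
  then show ?thesis
    using that[of "curry f"] f by auto
qed

subsection \<open>Diagonalizable closed loops\<close>

lemma representation_eigenbasis:
  fixes M :: "real^'n^'n"
  assumes ind: "independent E" and eig: "\<And>b. b \<in> E \<Longrightarrow> M *v b = l b *\<^sub>R b" and x: "x \<in> span E"
  shows "representation E (M *v x) b = l b * representation E x b"
proof -
  have Mspan: "M *v y \<in> span E" if "y \<in> span E" for y
    using that
  proof (induction rule: span_induct_alt)
    case (step c x y)
    then show ?case
      by (simp add: eig matrix_vector_right_distrib matrix_vector_mult_scaleR span_add span_scale span_base)
  qed (simp add: span_0)
  have "x \<in> span E \<and> representation E (M *v x) b = l b * representation E x b"
    using x
  proof (induction rule: span_induct_alt)
    case base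
    show ?case
      by (simp add: representation_zero span_0)
  next
    case (step c e y)
    have e: "e \<in> span E"
      using step by (simp add: span_base)
    have "M *v (c *\<^sub>R e + y) = (c * l e) *\<^sub>R e + M *v y"
      by (simp add: matrix_vector_right_distrib matrix_vector_mult_scaleR eig step(1))
    then have "representation E (M *v (c *\<^sub>R e + y)) b
        = c * (l e * representation E e b) + representation E (M *v y) b"
      using step by (simp add: representation_add[OF ind] representation_scale[OF ind] e Mspan span_scale)
    also have "l e * representation E e b = l b * representation E e b"
      using step(1) by (simp add: representation_basis[OF ind])
    finally show ?case
      using step e by (simp add: representation_add[OF ind] representation_scale[OF ind] span_scale span_add algebra_simps)
  qed
  then show ?thesis ..
qed

text \<open>Coordinates in the eigenbasis decouple the eigenvalue equation, and a nonzero
  eigenvector has a nonzero coordinate, which pins down \<mu>.\<close>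

lemma eigenvalue_in_eigenbasis:
  fixes M :: "real^'n^'n"
  assumes ind: "independent E" and eig: "\<And>b. b \<in> E \<Longrightarrow> M *v b = l b *\<^sub>R b"
    and z: "Re_vec z \<in> span E" "Im_vec z \<in> span E" "z \<noteq> 0" "cmat M *v z = \<mu> *s z"
  shows "\<exists>b\<in>E. \<mu> = of_real (l b)"
proof -
  let ?r = "\<lambda>x b. representation E x b"
  have "Re_vec z \<noteq> 0 \<or> Im_vec z \<noteq> 0"
    using z(3) by (auto simp: complex_vec_eq_iff)
  moreover have "x = 0" if "x \<in> span E" "\<And>b. ?r x b = 0" for x
    using sum_nonzero_representation_eq[OF ind that(1)] by (simp add: that(2))
  ultimately obtain b where b: "?r (Re_vec z) b \<noteq> 0 \<or> ?r (Im_vec z) b \<noteq> 0"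
    using z(1,2) by meson
  then have "b \<in> E"
    using representation_ne_zero by blast
  have "M *v Re_vec z = Re \<mu> *\<^sub>R Re_vec z - Im \<mu> *\<^sub>R Im_vec z"
    "M *v Im_vec z = Re \<mu> *\<^sub>R Im_vec z + Im \<mu> *\<^sub>R Re_vec z"
    using z(4) by (simp_all add: complex_vec_eq_iff)
  then have eqs: "l b * ?r (Re_vec z) b = Re \<mu> * ?r (Re_vec z) b - Im \<mu> * ?r (Im_vec z) b"
    "l b * ?r (Im_vec z) b = Re \<mu> * ?r (Im_vec z) b + Im \<mu> * ?r (Re_vec z) b"
    using representation_eigenbasis[OF ind eig z(1), of b] representation_eigenbasis[OF ind eig z(2), of b] z(1,2)
    by (simp_all add: representation_add[OF ind] representation_diff[OF ind] representation_scale[OF ind] span_scale)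
  \<comment> \<open>The complex coordinate of \<open>z\<close> at \<open>b\<close>; it merges the
    two real equations into one complex equation.\<close>
  define c where "c = Complex (?r (Re_vec z) b) (?r (Im_vec z) b)"
  have "of_real (l b) * c = \<mu> * c"
    using eqs by (simp add: c_def complex_eq_iff)
  moreover have "c \<noteq> 0"
    using b by (simp add: c_def complex_eq_iff)
  ultimately show ?thesis
    using \<open>b \<in> E\<close> by auto
qed

text \<open>Independence allows \<open>F\<close> to be prescribed on \<open>E\<close>; it is sent to
  the inputs \<open>w b\<close>.\<close>

lemma feedback_exists:
  fixes A :: "real^'n^'n" and B :: "real^'m^'n" and C :: "real^'n^'p" and D :: "real^'m^'p"
  assumes "independent E"
    and "\<And>b. b \<in> E \<Longrightarrow> \<exists>w. (A - mat (l b)) *v b + B *v w = 0 \<and> C *v b + D *v w = y b"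
  obtains F :: "real^'n^'m" where "\<And>b. b \<in> E \<Longrightarrow> (A + B ** F) *v b = l b *\<^sub>R b"
    "\<And>b. b \<in> E \<Longrightarrow> (C + D ** F) *v b = y b"
proof -
  obtain w where w: "\<And>b. b \<in> E \<Longrightarrow> (A - mat (l b)) *v b + B *v w b = 0 \<and> C *v b + D *v w b = y b"
    using assms(2) by metis
  obtain g where g: "linear g" "\<And>b. b \<in> E \<Longrightarrow> g b = w b"
    using linear_independent_extend[OF assms(1)] by metis
  have F: "matrix g *v b = w b" if "b \<in> E" for b
    using matrix_works[of g b] g that by (simp add: linear_matrix_vector_mul_eq)
  show ?thesis
  proof (rule that[of "matrix g"])
    fix b assume b: "b \<in> E"
    have "A *v b - l b *\<^sub>R b + B *v w b = 0"
      using w[OF b] by (simp add: mat_diff_mult_vec)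
    then have "A *v b + B *v w b = l b *\<^sub>R b"
      by (simp add: algebra_simps)
    then show "(A + B ** matrix g) *v b = l b *\<^sub>R b"
      by (simp add: matrix_vector_mult_add_rdistrib matrix_vector_mul_assoc[symmetric] F[OF b])
    show "(C + D ** matrix g) *v b = y b"
      using w[OF b] by (simp add: matrix_vector_mult_add_rdistrib matrix_vector_mul_assoc[symmetric] F[OF b])
  qed
qed

text \<open>A basis of null directions, with the feedback prescribed on it, shows that their span is
  itself a stabilizability output-nulling subspace. It contains every other one, so the greatest
  element exists and equals it.\<close>

theorem V_star_g_eq_span:
  fixes A :: "real^'n^'n" and B :: "real^'m^'n" and C :: "real^'n^'p" and D :: "real^'m^'p"
  assumes "right_invertible A B C D"
    and "\<And>z. z \<in> minimum_phase_zeros td A B C D \<Longrightarrow>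
      algebraic_multiplicity A B C D z = geometric_multiplicity A B C D z"
    and "minimum_phase_zeros td A B C D \<subseteq> \<real>"
  shows "V_star_g td A B C D = span (null_generators td A B C D)"
  unfolding V_star_g_def
proof (rule Greatest_equality)
  let ?N = "null_generators td A B C D"
  show "V \<le> span ?N" if "stabilizability_output_nulling td A B C D V" for V
    using stabilizability_output_nulling_le_span[OF assms that] .
  obtain E where E: "E \<subseteq> ?N" "independent E" "?N \<subseteq> span E"
    using basis_exists[of ?N] by metis
  have spanE: "span E = span ?N"
    using E span_mono span_minimal by (metis subset_antisym subspace_span)
  have "\<forall>b\<in>E. \<exists>l. l \<in> real_stability_region td \<and> (\<exists>w. (A - mat l) *v b + B *v w = 0 \<and> C *v b + D *v w = 0)"
    using E(1) unfolding null_generators_def by blast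
  then obtain l where l: "\<And>b. b \<in> E \<Longrightarrow> l b \<in> real_stability_region td"
    "\<And>b. b \<in> E \<Longrightarrow> \<exists>w. (A - mat (l b)) *v b + B *v w = 0 \<and> C *v b + D *v w = 0"
    by metis
  obtain F where F: "\<And>b. b \<in> E \<Longrightarrow> (A + B ** F) *v b = l b *\<^sub>R b"
    "\<And>b. b \<in> E \<Longrightarrow> (C + D ** F) *v b = 0"
    using feedback_exists[OF E(2), of A l B C D "\<lambda>_. 0"] l(2) by metis
  have "(A + B ** F) *v x \<in> span E \<and> (C + D ** F) *v x = 0" if "x \<in> span E" for x
    using that
  proof (induction rule: span_induct_alt)
    case (step c x y)
    then show ?case
      by (simp add: F matrix_vector_right_distrib matrix_vector_mult_scaleR span_add span_scale span_base
          del: matrix_vector_mult_add_rdistrib)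
  qed (simp add: span_0)
  moreover have "spectrum_on (A + B ** F) (span E) \<subseteq> stability_region td"
    using eigenvalue_in_eigenbasis[OF E(2) F(1)] l(1)
    by (fastforce simp: spectrum_on_def Re_vec_def Im_vec_def real_stability_region_def)
  ultimately show "stabilizability_output_nulling td A B C D (span ?N)"
    unfolding stabilizability_output_nulling_def spanE[symmetric]
    by (intro conjI exI[of _ F]) auto
qed

lemma stabilizing_eigenbasis:
  assumes "independent E" "span E = UNIV" "\<And>b. b \<in> E \<Longrightarrow> (A + B ** F) *v b = l b *\<^sub>R b"
    "\<And>b. b \<in> E \<Longrightarrow> l b \<in> real_stability_region td"
  shows "stabilizing td A B F"
  using eigenvalue_in_eigenbasis[OF assms(1,3)] assms(2,4)
  by (fastforce simp: stabilizing_def spectrum_on_def real_stability_region_def)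

lemma stabilizing_real_eigenvalue:
  assumes "stabilizing td A B F" "(A + B ** F) *v v = l *\<^sub>R v" "v \<noteq> 0"
  shows "l \<in> real_stability_region td"
proof -
  have "cmat (A + B ** F) *v cvec v = of_real l *s cvec v"
    using assms(2) by (simp add: complex_vec_eq_iff del: matrix_vector_mult_add_rdistrib)
  moreover have "cvec v \<noteq> 0"
    using assms(3) by (simp add: complex_vec_eq_iff)
  ultimately have "of_real l \<in> spectrum_on (A + B ** F) UNIV"
    by (auto simp: spectrum_on_def)
  then show ?thesis
    using assms(1) by (auto simp: stabilizing_def real_stability_region_def)
qed

section \<open>Static gain and tracking of constant references\<close>

lemma
  fixes A :: "'a::semiring_1^'n^'m"
  assumes "invertible A"
  shows matrix_inv_right: "A ** matrix_inv A = mat 1"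
    and matrix_inv_left: "matrix_inv A ** A = mat 1"
  using someI_ex[OF assms[unfolded invertible_def]] by (simp_all add: matrix_inv_def)

lemma static_frequency_unstable: "static_frequency td \<notin> real_stability_region td"
  by (cases td) (auto simp: real_stability_region_def)

text \<open>A kernel vector would be an eigenvector of the closed loop at 0 or 1, outside the
  stability region.\<close>

lemma static_resolvent_invertible:
  assumes "stabilizing td A B F"
  shows "invertible (mat (static_frequency td) - (A + B ** F))"
proof -
  let ?K = "mat (static_frequency td) - (A + B ** F)"
  have "x = 0" if "?K *v x = 0" for x
  proof (rule ccontr)
    assume "x \<noteq> 0"
    moreover have "(A + B ** F) *v x = static_frequency td *\<^sub>R x"
      using that by (simp add: matrix_vector_mult_diff_rdistrib mat_mult_vec scalar_mult_eq_scaleR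
          del: matrix_vector_mult_add_rdistrib)
    ultimately show False
      using stabilizing_real_eigenvalue[OF assms] static_frequency_unstable by blast
  qed
  then show ?thesis
    by (simp add: invertible_left_inverse matrix_left_invertible_ker)
qed

text \<open>Without an invariant zero at the static frequency the pencil is onto there, so every
  output \<open>r\<close> belongs to an equilibrium (x, u).\<close>

lemma static_gain_right_inverse_exists:
  fixes A :: "real^'n^'n" and B :: "real^'m^'n" and C :: "real^'n^'p" and D :: "real^'m^'p"
  assumes "right_invertible A B C D" "stabilizing td A B F"
    and "complex_of_real (static_frequency td) \<notin> invariant_zeros A B C D"
  obtains G where "static_gain td A B C D F ** G = mat 1"
proof -
  let ?s = "static_frequency td"
  let ?K = "mat ?s - (A + B ** F)"
  have inv: "invertible ?K"
    by (rule static_resolvent_invertible[OF assms(2)])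
  have "rank (pencil A B C D ?s) = CARD('n + 'p)"
    using assms(3) rank_le_rows[of "pencil A B C D ?s"] normal_rank_right_invertible(1)[OF assms(1)]
    by (simp add: invariant_zeros_def)
  then have surj: "surj ((*v) (pencil A B C D ?s))"
    by (simp only: surj_iff_full_row_rank)
  have "\<exists>u. static_gain td A B C D F *v u = r" for r
  proof -
    obtain z where "pencil A B C D ?s *v z = join_vec 0 (cvec r)"
      using surj by (metis surjD)
    then obtain x u where "pencil A B C D ?s *v join_vec x u = join_vec 0 (cvec r)"
      by (metis join_vec_cases)
    then have "cmat A *v x - of_real ?s *s x + cmat B *v u = 0" "cmat C *v x + cmat D *v u = cvec r"
      by (simp_all add: pencil_join_vec vec_sum_eq_iff vec_eq_iff)
    then have xu: "A *v Re_vec x - ?s *\<^sub>R Re_vec x + B *v Re_vec u = 0" "C *v Re_vec x + D *v Re_vec u = r"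
      by (simp_all add: complex_vec_eq_iff)
    \<comment> \<open>The feedback already supplies \<open>F x\<close>; the rest of the equilibrium
      input is the external one.\<close>
    let ?u = "Re_vec u - F *v Re_vec x"
    have "?K *v Re_vec x = B *v ?u"
      using xu(1) by (simp add: matrix_vector_mult_diff_rdistrib mat_mult_vec scalar_mult_eq_scaleR
          matrix_vector_mult_add_rdistrib matrix_vector_mult_diff_distrib matrix_vector_mul_assoc algebra_simps)
    then have "matrix_inv ?K *v (B *v ?u) = Re_vec x"
      by (metis inv matrix_inv_left matrix_vector_mul_assoc matrix_vector_mul_lid)
    then have "static_gain td A B C D F *v ?u = (C + D ** F) *v Re_vec x + D *v ?u"
      by (simp add: static_gain_def matrix_vector_mult_add_rdistrib[of _ D]
          matrix_vector_mul_assoc[symmetric])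
    also have "\<dots> = r"
      using xu(2) by (simp add: matrix_vector_mult_add_rdistrib matrix_vector_mult_diff_distrib
          matrix_vector_mul_assoc)
    finally show ?thesis ..
  qed
  then have "surj ((*v) (static_gain td A B C D F))"
    by (metis surjI)
  then show ?thesis
    using that matrix_right_invertible_surjective by blast
qed

lemma tendsto_0_by_coordinates:
  fixes e :: "'t \<Rightarrow> real^'n"
  assumes "independent E" "span E = UNIV" "\<And>b. b \<in> E \<Longrightarrow> ((\<lambda>t. representation E (e t) b) \<longlongrightarrow> 0) net"
  shows "(e \<longlongrightarrow> 0) net"
proof -
  have fin: "finite E"
    by (rule finiteI_independent[OF assms(1)])
  have e: "e t = (\<Sum>b\<in>E. representation E (e t) b *\<^sub>R b)" for t
    using sum_representation_eq[OF assms(1) _ fin, of "e t"] assms(2) by simp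
  have "((\<lambda>t. \<Sum>b\<in>E. representation E (e t) b *\<^sub>R b) \<longlongrightarrow> (\<Sum>b\<in>E. 0 *\<^sub>R b)) net"
    by (intro tendsto_intros assms(3))
  then show ?thesis
    unfolding e[symmetric] by simp
qed

lemma linear_representation:
  fixes E :: "'a::euclidean_space set"
  assumes "independent E" "span E = UNIV"
  shows "linear (\<lambda>x. representation E x b)"
  by (intro linearI) (simp_all add: representation_add[OF assms(1)] representation_scale[OF assms(1)] assms(2))

text \<open>The integrating factor makes \<open>c t * exp (- l * t)\<close> constant.\<close>

lemma scalar_linear_ode_decay:
  fixes c :: "real \<Rightarrow> real"
  assumes "l < 0" "\<And>t. t \<ge> 0 \<Longrightarrow> (c has_vector_derivative l * c t) (at t within {0..})"
  shows "(c \<longlongrightarrow> 0) at_top"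
proof -
  have "((\<lambda>t. c t * exp (- l * t)) has_field_derivative 0) (at t within {0..})" if "t \<in> {0..}" for t
  proof -
    have "(c has_field_derivative l * c t) (at t within {0..})"
      using assms(2)[of t] that by (simp add: has_real_derivative_iff_has_vector_derivative)
    then show ?thesis
      by (auto intro!: derivative_eq_intros simp: algebra_simps)
  qed
  then have "\<exists>k. \<forall>t\<in>{0..}. c t * exp (- l * t) = k"
    by (intro has_field_derivative_zero_constant) (auto simp: convex_real_interval)
  then obtain k where k: "\<And>t. t \<ge> 0 \<Longrightarrow> c t * exp (- l * t) = k"
    by auto
  have c: "c t = k * exp (l * t)" if "t \<ge> 0" for t
    using k[OF that] by (auto simp: exp_minus field_simps)
  have "((\<lambda>t. k * exp (l * t)) \<longlongrightarrow> 0) at_top"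
    using assms(1) by (auto intro!: tendsto_mult_right_zero exp_at_bot[THEN filterlim_compose]
        filterlim_tendsto_neg_mult_at_bot[OF tendsto_const _ filterlim_ident])
  then show ?thesis
    by (rule Lim_transform_eventually) (auto intro!: eventually_mono[OF eventually_ge_at_top[of 0]] simp: c)
qed

text \<open>The deviation from the equilibrium \<open>xb r\<close> obeys the homogeneous closed
  loop, whose coordinates in the eigenbasis are independent decaying scalars. The choice of
  \<open>G\<close> makes the output at the equilibrium equal to \<open>r\<close>.\<close>

lemma tracks_constants_eigenbasis:
  fixes A :: "real^'n^'n" and B :: "real^'m^'n" and C :: "real^'n^'p" and D :: "real^'m^'p"
  assumes E: "independent E" "span E = UNIV" and eig: "\<And>b. b \<in> E \<Longrightarrow> (A + B ** F) *v b = l b *\<^sub>R b"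
    and l: "\<And>b. b \<in> E \<Longrightarrow> l b \<in> real_stability_region td"
    and G: "static_gain td A B C D F ** G = mat 1"
  shows "tracks_constants td A B C D F G"
proof -
  let ?s = "static_frequency td" and ?M = "A + B ** F"
  let ?K = "mat ?s - ?M"
  define xb where "xb r = matrix_inv ?K *v (B *v (G *v r))" for r
  have inv: "invertible ?K"
    using stabilizing_eigenbasis[OF E eig l] by (rule static_resolvent_invertible)
  have equilibrium: "?M *v xb r + B *v (G *v r) = ?s *\<^sub>R xb r" for r
  proof -
    have "?K *v xb r = B *v (G *v r)"
      unfolding xb_def by (metis inv matrix_inv_right matrix_vector_mul_assoc matrix_vector_mul_lid)
    then show ?thesis
      by (simp add: matrix_vector_mult_diff_rdistrib mat_mult_vec scalar_mult_eq_scaleR algebra_simps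
          del: matrix_vector_mult_add_rdistrib)
  qed
  have static_output: "(C + D ** F) *v xb r + D *v (G *v r) = r" for r
  proof -
    have "static_gain td A B C D F *v (G *v r) = r"
      by (metis G matrix_vector_mul_assoc matrix_vector_mul_lid)
    then show ?thesis
      by (simp add: static_gain_def xb_def matrix_vector_mult_add_rdistrib[of _ D] matrix_vector_mul_assoc[symmetric])
  qed
  have y: "C *v x + D *v u = (C + D ** F) *v (x - xb r) + r" if "u = F *v x + G *v r" for x u r
  proof -
    have "C *v x + D *v u = (C + D ** F) *v x + D *v (G *v r)"
      by (simp add: that matrix_vector_mult_add_rdistrib matrix_vector_right_distrib matrix_vector_mul_assoc)
    also have "\<dots> = (C + D ** F) *v x - (C + D ** F) *v xb r + r"
      using static_output[of r] by (simp add: algebra_simps)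
    finally show ?thesis
      by (simp add: matrix_vector_mult_diff_distrib)
  qed
  have dyn: "A *v x + B *v u = ?M *v (x - xb r) + ?s *\<^sub>R xb r" if "u = F *v x + G *v r" for x u r
  proof -
    have "A *v x + B *v u = ?M *v x + B *v (G *v r)"
      by (simp add: that matrix_vector_mult_add_rdistrib matrix_vector_right_distrib matrix_vector_mul_assoc)
    also have "\<dots> = ?M *v x - ?M *v xb r + ?s *\<^sub>R xb r"
      using equilibrium[of r] by (simp add: algebra_simps)
    finally show ?thesis
      by (simp add: matrix_vector_mult_diff_distrib)
  qed
  have coord: "representation E (?M *v x) b = l b * representation E x b" for x b
    by (rule representation_eigenbasis[OF E(1) eig]) (simp_all add: E(2))
  have lin: "linear (\<lambda>x. representation E x b)" for b
    by (rule linear_representation[OF E])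
  have out: "((\<lambda>t. (C + D ** F) *v e t + r) \<longlongrightarrow> r) net" if "(e \<longlongrightarrow> 0) net" for e :: "'t \<Rightarrow> real^'n" and r net
  proof -
    have "((\<lambda>t. (C + D ** F) *v e t) \<longlongrightarrow> (C + D ** F) *v 0) net"
      by (rule bounded_linear.tendsto[OF matrix_vector_mul_bounded_linear that])
    from tendsto_add[OF this tendsto_const[of r]] show ?thesis
      by simp
  qed
  show ?thesis
  proof (cases td)
    case Continuous
    have "((\<lambda>t. C *v x t + D *v u t) \<longlongrightarrow> r) at_top"
      if u: "\<forall>t\<ge>0. u t = F *v x t + G *v r"
        and x: "\<forall>t\<ge>0. (x has_vector_derivative (A *v x t + B *v u t)) (at t within {0..})"
      for r and x :: "real \<Rightarrow> real^'n" and u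
    proof -
      define e where "e t = x t - xb r" for t
      have e': "(e has_vector_derivative ?M *v e t) (at t within {0..})" if "t \<ge> 0" for t
        using x u that dyn[of "u t" "x t" r] Continuous unfolding e_def
        by (auto intro!: derivative_eq_intros simp del: matrix_vector_mult_add_rdistrib)
      have "(e \<longlongrightarrow> 0) at_top"
      proof (rule tendsto_0_by_coordinates[OF E])
        fix b assume b: "b \<in> E"
        show "((\<lambda>t. representation E (e t) b) \<longlongrightarrow> 0) at_top"
        proof (rule scalar_linear_ode_decay)
          show "l b < 0"
            using l[OF b] Continuous by (simp add: real_stability_region_def)
          fix t :: real assume "t \<ge> 0"
          from bounded_linear.has_vector_derivative[OF _ e'[OF this], of "\<lambda>x. representation E x b"]
          show "((\<lambda>t. representation E (e t) b) has_vector_derivative l b * representation E (e t) b) (at t within {0..})"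
            using lin by (simp add: coord linear_conv_bounded_linear del: matrix_vector_mult_add_rdistrib)
        qed
      qed
      from out[OF this, of r] show ?thesis
        by (rule Lim_transform_eventually)
           (auto intro!: eventually_mono[OF eventually_ge_at_top[of 0]] simp: y[of _ _ r] u e_def)
    qed
    then show ?thesis
      using Continuous by simp
  next
    case Discrete
    have "(\<lambda>t. C *v x t + D *v u t) \<longlonglongrightarrow> r"
      if u: "\<forall>t. u t = F *v x t + G *v r" and x: "\<forall>t. x (Suc t) = A *v x t + B *v u t"
      for r and x :: "nat \<Rightarrow> real^'n" and u
    proof -
      define e where "e t = x t - xb r" for t
      have e': "e (Suc t) = ?M *v e t" for t
        using x u dyn[of "u t" "x t" r] Discrete unfolding e_def by simp
      have "e \<longlonglongrightarrow> 0"
      proof (rule tendsto_0_by_coordinates[OF E])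
        fix b assume b: "b \<in> E"
        have "representation E (e t) b = l b ^ t * representation E (e 0) b" for t
          by (induction t) (simp_all add: e' coord del: matrix_vector_mult_add_rdistrib)
        then have eq: "(\<lambda>t. representation E (e t) b) = (\<lambda>t. l b ^ t * representation E (e 0) b)"
          by (rule ext)
        have "\<bar>l b\<bar> < 1"
          using l[OF b] Discrete by (simp add: real_stability_region_def)
        then show "(\<lambda>t. representation E (e t) b) \<longlonglongrightarrow> 0"
          unfolding eq by (intro tendsto_mult_left_zero LIMSEQ_power_zero) simp
      qed
      from out[OF this, of r] show ?thesis
        by (simp add: y[of _ _ r] u e_def)
    qed
    then show ?thesis
      using Discrete by simp
  qed
qed

section \<open>Dimension counts and the solvability criterion\<close>

lemma sum_span_eq_span_Union:
  fixes S :: "'i \<Rightarrow> 'a::real_vector set"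
  assumes "finite P"
  shows "(\<Sum>i\<in>P. span (S i)) = span (\<Union>i\<in>P. S i)"
  using assms by induction (auto simp: span_Un set_plus_def)

text \<open>Necessity of the conditions: the family members with index in \<open>P\<close> are
  independent vectors of \<open>S\<close>.\<close>

lemma card_le_sum_family:
  fixes v :: "'k \<Rightarrow> nat \<Rightarrow> 'a::euclidean_space"
  assumes inj: "inj_on (\<lambda>(k, j). v k j) (SIGMA k:UNIV. {..<\<mu> k})"
    and ind: "independent ((\<lambda>(k, j). v k j) ` (SIGMA k:UNIV. {..<\<mu> k}))"
    and v: "\<And>k j. k \<in> P \<Longrightarrow> j < \<mu> k \<Longrightarrow> v k j \<in> S" and P: "finite P"
  shows "(\<Sum>k\<in>P. \<mu> k) \<le> dim S"
proof -
  let ?J = "SIGMA k:P. {..<\<mu> k}"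
  have sub: "?J \<subseteq> (SIGMA k:UNIV. {..<\<mu> k})"
    by auto
  have "(\<Sum>k\<in>P. \<mu> k) = card ?J"
    using P by (simp add: card_SigmaI)
  also have "\<dots> = card ((\<lambda>(k, j). v k j) ` ?J)"
    using inj_on_subset[OF inj sub] by (simp add: card_image)
  also have "\<dots> \<le> dim S"
    using v by (intro independent_card_le_dim independent_mono[OF ind] image_mono sub) auto
  finally show ?thesis .
qed

theorem theorem16:
  fixes td :: time_domain
    and A :: "real^'n^'n" and B :: "real^'m^'n" and C :: "real^'n^'p" and D :: "real^'m^'p"
    and \<nu> :: "'p \<Rightarrow> nat" and \<nu>0 :: nat
  assumes "right_invertible A B C D"
    and "stabilizable td A B"
    and "complex_of_real (static_frequency td) \<notin> invariant_zeros A B C D"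
    and "\<And>z. z \<in> minimum_phase_zeros td A B C D \<Longrightarrow>
           algebraic_multiplicity A B C D z = geometric_multiplicity A B C D z"
    and "minimum_phase_zeros td A B C D \<subseteq> \<real>"
    and "(\<Sum>i\<in>UNIV. \<nu> i) \<le> CARD('n)"
    and "\<nu>0 = CARD('n) - (\<Sum>i\<in>UNIV. \<nu> i)"
  shows "problem_2C_solvable td A B C D \<nu> \<longleftrightarrow>
    (\<forall>P :: 'p set.
       dim (V_star_g td A B C D + (\<Sum>i\<in>P. L_space td A B C D i)) \<ge> (\<Sum>i\<in>P. \<nu> i) + \<nu>0 \<and>
       dim (\<Sum>i\<in>P. L_space td A B C D i) \<ge> (\<Sum>i\<in>P. \<nu> i))"
proof -
  define \<mu> where "\<mu> = (\<lambda>k. case k of None \<Rightarrow> CARD('n) - (\<Sum>i\<in>UNIV. \<nu> i) | Some i \<Rightarrow> \<nu> i)"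
  define gen where "gen k = (case k of None \<Rightarrow> null_generators td A B C D
    | Some i \<Rightarrow> L_generators td A B C D i)" for k
  have dim_L: "dim (\<Sum>i\<in>P. L_space td A B C D i) = dim (\<Union>k\<in>Some ` P. gen k)" for P
    by (simp add: L_space_def sum_span_eq_span_Union gen_def image_image)
  have dim_V: "dim (V_star_g td A B C D + (\<Sum>i\<in>P. L_space td A B C D i))
      = dim (\<Union>k\<in>insert None (Some ` P). gen k)" for P
  proof -
    have "V_star_g td A B C D + (\<Sum>i\<in>P. L_space td A B C D i)
        = span (null_generators td A B C D \<union> (\<Union>i\<in>P. L_generators td A B C D i))"
      using V_star_g_eq_span[OF assms(1,4,5)]
      by (auto simp: L_space_def sum_span_eq_span_Union span_Un set_plus_def)
    then show ?thesis
      by (simp add: gen_def image_image)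
  qed
  have sum_L: "(\<Sum>k\<in>Some ` P. \<mu> k) = (\<Sum>i\<in>P. \<nu> i)" for P
    by (simp add: sum.reindex \<mu>_def)
  have \<mu>_None: "\<mu> None = \<nu>0"
    by (simp add: \<mu>_def assms(7))
  have sum_V: "(\<Sum>k\<in>insert None (Some ` P). \<mu> k) = (\<Sum>i\<in>P. \<nu> i) + \<nu>0" for P
    by (subst sum.insert) (auto simp: sum_L \<mu>_None)
  have total: "(\<Sum>k\<in>UNIV. \<mu> k) = CARD('n)"
    using sum_V[of UNIV] assms(6,7) by (simp add: UNIV_option_conv)
  have conditions: "(\<forall>P. dim (V_star_g td A B C D + (\<Sum>i\<in>P. L_space td A B C D i)) \<ge> (\<Sum>i\<in>P. \<nu> i) + \<nu>0 \<and>
       dim (\<Sum>i\<in>P. L_space td A B C D i) \<ge> (\<Sum>i\<in>P. \<nu> i))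
     \<longleftrightarrow> (\<forall>Q. (\<Sum>k\<in>Q. \<mu> k) \<le> dim (\<Union>k\<in>Q. gen k))" (is "?L \<longleftrightarrow> ?R")
  proof
    assume L: ?L
    show ?R
    proof
      fix Q :: "'p option set"
      \<comment> \<open>The two conditions for \<open>P\<close> are the rank conditions for the two
        subsets of \<open>'p option\<close> that agree with \<open>P\<close> on the
        \<open>Some\<close> part.\<close>
      define P where "P = {i. Some i \<in> Q}"
      have "k \<in> Q \<longleftrightarrow> (if None \<in> Q then k \<in> insert None (Some ` P) else k \<in> Some ` P)" for k
        by (cases k) (auto simp: P_def)
      then have "Q = Some ` P \<or> Q = insert None (Some ` P)"
        by (metis subsetI subset_antisym)
      then show "(\<Sum>k\<in>Q. \<mu> k) \<le> dim (\<Union>k\<in>Q. gen k)"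
        using L[rule_format, of P] by (elim disjE) (simp_all only: dim_L dim_V sum_L sum_V)
    qed
  next
    assume ?R
    then show ?L
      unfolding dim_L dim_V by (metis sum_L sum_V)
  qed
  show ?thesis
    unfolding conditions
  proof
    assume "problem_2C_solvable td A B C D \<nu>"
    then obtain F v l where stab: "stabilizing td A B F"
      and inj: "inj_on (\<lambda>(k, j). v k j) (SIGMA k:UNIV. {..<\<mu> k})"
      and ind: "independent ((\<lambda>(k, j). v k j) ` (SIGMA k:UNIV. {..<\<mu> k}))"
      and eig: "\<And>k j. j < \<mu> k \<Longrightarrow> (A + B ** F) *v v k j = l k j *\<^sub>R v k j"
      and out_None: "\<And>j. j < \<mu> None \<Longrightarrow> (C + D ** F) *v v None j = 0"
      and out_Some: "\<And>i j. j < \<mu> (Some i) \<Longrightarrow> \<exists>d. d \<noteq> 0 \<and> (C + D ** F) *v v (Some i) j = d *\<^sub>R axis i 1"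
      unfolding problem_2C_solvable_def state_output_decoupled_def Let_def \<mu>_def[symmetric] by metis
    have "v k j \<in> gen k" if j: "j < \<mu> k" for k j
    proof -
      have "v k j \<in> (\<lambda>(k, j). v k j) ` (SIGMA k:UNIV. {..<\<mu> k})"
        using j by force
      then have "v k j \<noteq> 0"
        using ind dependent_zero by metis
      then have l: "l k j \<in> real_stability_region td"
        using stabilizing_real_eigenvalue[OF stab eig[OF j]] by blast
      have w: "(A - mat (l k j)) *v v k j + B *v (F *v v k j) = 0"
        unfolding mat_diff_mult_vec
        using eig[OF j] by (simp add: matrix_vector_mult_add_rdistrib matrix_vector_mul_assoc algebra_simps)
      have out: "C *v v k j + D *v (F *v v k j) = (C + D ** F) *v v k j"
        by (simp add: matrix_vector_mult_add_rdistrib matrix_vector_mul_assoc)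
      show ?thesis
      proof (cases k)
        case None
        then show ?thesis
          using l w out j out_None
          unfolding gen_def null_generators_def by auto
      next
        case (Some i)
        then obtain d where "d \<noteq> 0" "(C + D ** F) *v v k j = d *\<^sub>R axis i 1"
          using j out_Some by blast
        then have "v k j \<in> L_generators td A B C D i"
          unfolding L_generators_def using l w out by (metis (mono_tags, lifting) mem_Collect_eq)
        then show ?thesis
          using Some by (simp add: gen_def)
      qed
    qed
    then show "\<forall>Q. (\<Sum>k\<in>Q. \<mu> k) \<le> dim (\<Union>k\<in>Q. gen k)"
      using card_le_sum_family[OF inj ind] by (metis UN_I finite)
  next
    assume "\<forall>Q. (\<Sum>k\<in>Q. \<mu> k) \<le> dim (\<Union>k\<in>Q. gen k)"
    then obtain v where v: "\<And>k j. j < \<mu> k \<Longrightarrow> v k j \<in> gen k"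
      and inj: "inj_on (\<lambda>(k, j). v k j) (SIGMA k:UNIV. {..<\<mu> k})"
      and ind: "independent ((\<lambda>(k, j). v k j) ` (SIGMA k:UNIV. {..<\<mu> k}))"
      using rado_multiplicities[of \<mu> gen] by metis
    let ?J = "SIGMA k:UNIV. {..<\<mu> k}"
    let ?E = "(\<lambda>(k, j). v k j) ` ?J"
    have "card ?E = CARD('n)"
      using total inj by (simp add: card_image card_SigmaI)
    then have span: "span ?E = UNIV"
      using card_ge_dim_independent[of ?E UNIV] ind by (simp add: dim_UNIV subset_antisym)
    \<comment> \<open>Eigenvalue and output are chosen together, since both must belong to one input
      \<open>w\<close>.\<close>
    define Q where "Q k j l y \<longleftrightarrow> l \<in> real_stability_region td \<and>
        (\<exists>w. (A - mat l) *v v k j + B *v w = 0 \<and> C *v v k j + D *v w = y) \<and>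
        (case k of None \<Rightarrow> y = 0 | Some i \<Rightarrow> \<exists>d. d \<noteq> 0 \<and> y = d *\<^sub>R axis i 1)" for k j l y
    have "\<exists>l y. Q k j l y" if "j < \<mu> k" for k j
      using v[OF that]
      by (cases k; simp add: Q_def gen_def null_generators_def L_generators_def; blast)
    then have "\<forall>k j. \<exists>l y. j < \<mu> k \<longrightarrow> Q k j l y"
      by blast
    then obtain l y where "\<And>k j. j < \<mu> k \<Longrightarrow> Q k j (l k j) (y k j)"
      unfolding choice_iff by blast
    then have ly: "\<And>k j. j < \<mu> k \<Longrightarrow> l k j \<in> real_stability_region td"
      "\<And>k j. j < \<mu> k \<Longrightarrow> \<exists>w. (A - mat (l k j)) *v v k j + B *v w = 0 \<and> C *v v k j + D *v w = y k j"
      "\<And>k j. j < \<mu> k \<Longrightarrow> case k of None \<Rightarrow> y k j = 0 | Some i \<Rightarrow> \<exists>d. d \<noteq> 0 \<and> y k j = d *\<^sub>R axis i 1"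
      unfolding Q_def by blast+
    \<comment> \<open>\<open>feedback_exists\<close> takes eigenvalues and outputs as functions of
      the basis vector; injectivity recovers the index from the vector.\<close>
    define ix where "ix = inv_into ?J (\<lambda>(k, j). v k j)"
    have ix: "ix (v k j) = (k, j)" if "j < \<mu> k" for k j
      using inv_into_f_f[OF inj, of "(k, j)"] that by (simp add: ix_def)
    define lE where "lE b = (case ix b of (k, j) \<Rightarrow> l k j)" for b
    define yE where "yE b = (case ix b of (k, j) \<Rightarrow> y k j)" for b
    have "\<exists>w. (A - mat (lE b)) *v b + B *v w = 0 \<and> C *v b + D *v w = yE b" if "b \<in> ?E" for b
      using that ly(2) by (auto simp: ix lE_def yE_def)
    then obtain F where F: "\<And>b. b \<in> ?E \<Longrightarrow> (A + B ** F) *v b = lE b *\<^sub>R b"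
      "\<And>b. b \<in> ?E \<Longrightarrow> (C + D ** F) *v b = yE b"
      using feedback_exists[OF ind, of A lE B C D yE] by metis
    have lE: "lE b \<in> real_stability_region td" if "b \<in> ?E" for b
      using that ly(1) by (auto simp: ix lE_def)
    have stab: "stabilizing td A B F"
      using stabilizing_eigenbasis[OF ind span F(1) lE] .
    obtain G where G: "static_gain td A B C D F ** G = mat 1"
      using static_gain_right_inverse_exists[OF assms(1) stab assms(3)] by blast
    have track: "tracks_constants td A B C D F G"
      using tracks_constants_eigenbasis[OF ind span F(1) lE G] .
    have memE: "v k j \<in> ?E" if "j < \<mu> k" for k j
      using that by force
    have "(A + B ** F) *v v k j = l k j *\<^sub>R v k j" "(C + D ** F) *v v k j = y k j" if "j < \<mu> k" for k j
      using F[OF memE[OF that]] by (simp_all add: ix[OF that] lE_def yE_def)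
    then have "state_output_decoupled A B C D F \<mu>"
      unfolding state_output_decoupled_def Let_def
      using inj ind span ly(3)[of _ None] ly(3)[of _ "Some _"]
      by (intro exI[of _ v] exI[of _ l]) auto
    then show "problem_2C_solvable td A B C D \<nu>"
      unfolding problem_2C_solvable_def \<mu>_def[symmetric] using stab G track by blast
  qed
qed

end
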